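(* Let $\mathcal{E}$ be the class of Kalmár elementary functions. Then the closure under substitution generated by the binary operations $(x,y)\mapsto x+y$ and $(x,y)\mapsto x \bmod y$ and the unary operation $x\mapsto 2^x$ (together with all constant operations and all projections) is exactly $\mathcal{E}$: $$\langle x+y,\ x\bmod y,\ 2^x\rangle=\mathcal{E}.$$
   Context: $\mathbb{N}$ is the set of non-negative integers. An ($r$-ary, $r\ge 1$) operation on $\mathbb{N}$ is a function $\mathbb{N}^r\to\mathbb{N}$. Truncated subtraction is $x \mathbin{\dot-} y:=\max(x-y,0)$. Conventions: $\lfloor x/0\rfloor:=0$, and $x\bmod y:=x \mathbin{\dot-} y\lfloor x/y\rfloor$, so that $x\bmod 0=x$. A set $S$ of operations on $\mathbb{N}$ is closed under substitution if, whenever $f\in S$ is $r$-ary and $g_1,\dots,g_r\in S$ are $n$-ary, the operation $\vec x\mapsto f(g_1(\vec x),\dots,g_r(\vec x))$ is in $S$. For a set $\mathcal{B}$ of operations on $\mathbb{N}$, $\langle\mathcal{B}\rangle$ denotes the closure under substitution of $\mathcal{B}\cup C\cup P$, where $C$ is the set of all constant operations on $\mathbb{N}$ (of every arity) and $P$ is the set of all projections $(x_1,\dots,x_n)\mapsto x_i$. The Kalmár elementary functions, forming the class $\mathcal{E}$, are the elements of the smallest set of operations on $\mathbb{N}$ that contains the constants, the projections, the addition, and the truncated subtraction, and that is closed under substitution, bounded summation ($(\vec x,y)\mapsto\sum_{z<y}f(\vec x,z)$), and bounded multiplication ($(\vec x,y)\mapsto\prod_{z<y}f(\vec x,z)$).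 *)

theory Defs
  imports Main "HOL.Hull" "HOL-Library.FuncSet"
begin

text \<open>An operation is a pair of its arity and a function on argument lists; outside the lists of
  the right length the function is \<^const>\<open>undefined\<close>, so that equality of such
  pairs is equality of operations. Argument positions are numbered from 0.\<close>

type_synonym operation = "nat \<times> (nat list \<Rightarrow> nat)"

definition operations :: "operation set" where
  "operations = {(r, f). 1 \<le> r \<and> f \<in> extensional {xs. length xs = r}}"

definition mk_op :: "nat \<Rightarrow> (nat list \<Rightarrow> nat) \<Rightarrow> operation" where
  "mk_op r f = (r, restrict f {xs. length xs = r})"

definition const_ops :: "operation set" where
  "const_ops = {mk_op r (\<lambda>xs. c) | r c. 1 \<le> r}"

definition proj_ops :: "operation set" where
  "proj_ops = {mk_op n (\<lambda>xs. xs ! i) | n i. i < n}"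

definition unary_op :: "(nat \<Rightarrow> nat) \<Rightarrow> operation" where
  "unary_op h = mk_op 1 (\<lambda>xs. h (xs ! 0))"

definition binary_op :: "(nat \<Rightarrow> nat \<Rightarrow> nat) \<Rightarrow> operation" where
  "binary_op h = mk_op 2 (\<lambda>xs. h (xs ! 0) (xs ! 1))"

definition closed_under_substitution :: "operation set \<Rightarrow> bool" where
  "closed_under_substitution S \<longleftrightarrow>
     (\<forall>r f n gs. (r, f) \<in> S \<longrightarrow> length gs = r \<longrightarrow> (\<forall>g \<in> set gs. (n, g) \<in> S) \<longrightarrow>
        mk_op n (\<lambda>xs. f (map (\<lambda>g. g xs) gs)) \<in> S)"

text \<open>The last argument is the bound; the list of remaining arguments may be empty.\<close>

definition closed_under_bounded_sum :: "operation set \<Rightarrow> bool" where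
  "closed_under_bounded_sum S \<longleftrightarrow>
     (\<forall>n f. (Suc n, f) \<in> S \<longrightarrow>
        mk_op (Suc n) (\<lambda>xs. \<Sum>z<last xs. f (butlast xs @ [z])) \<in> S)"

definition closed_under_bounded_prod :: "operation set \<Rightarrow> bool" where
  "closed_under_bounded_prod S \<longleftrightarrow>
     (\<forall>n f. (Suc n, f) \<in> S \<longrightarrow>
        mk_op (Suc n) (\<lambda>xs. \<Prod>z<last xs. f (butlast xs @ [z])) \<in> S)"

definition substitution_closure :: "operation set \<Rightarrow> operation set" where
  "substitution_closure B =
     (\<lambda>S. S \<subseteq> operations \<and> closed_under_substitution S) hull (B \<union> const_ops \<union> proj_ops)"

definition kalmar_elementary :: "operation set" where
  "kalmar_elementary =
     (\<lambda>S. S \<subseteq> operations \<and> closed_under_substitution S \<and>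
          closed_under_bounded_sum S \<and> closed_under_bounded_prod S)
     hull (const_ops \<union> proj_ops \<union> {binary_op (+), binary_op (-)})"

text \<open>The hulls are taken over nonempty families: the set of all operations qualifies.\<close>

lemma mk_op_in_operations: "1 \<le> r \<Longrightarrow> mk_op r f \<in> operations"
  by (simp add: mk_op_def operations_def)

lemma operations_closed:
  "closed_under_substitution operations"
  "closed_under_bounded_sum operations"
  "closed_under_bounded_prod operations"
proof -
  show "closed_under_substitution operations"
    unfolding closed_under_substitution_def
  proof (intro allI impI)
    fix r f n gs
    assume "(r, f) \<in> operations" "length gs = r" and gs: "\<forall>g \<in> set gs. (n, g) \<in> operations"
    then have "gs \<noteq> []"
      by (auto simp: operations_def)
    then have "1 \<le> n"
      using gs by (cases gs) (auto simp: operations_def)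
    then show "mk_op n (\<lambda>xs. f (map (\<lambda>g. g xs) gs)) \<in> operations"
      by (rule mk_op_in_operations)
  qed
qed (simp_all add: closed_under_bounded_sum_def closed_under_bounded_prod_def mk_op_in_operations)

lemma kalmar_elementary_subset_operations: "kalmar_elementary \<subseteq> operations"
  unfolding kalmar_elementary_def
  by (rule hull_minimal)
    (auto simp: operations_closed const_ops_def proj_ops_def binary_op_def mk_op_in_operations)

lemma substitution_closure_subset_operations:
  "B \<subseteq> operations \<Longrightarrow> substitution_closure B \<subseteq> operations"
  unfolding substitution_closure_def
  by (rule hull_minimal)
    (auto simp: operations_closed const_ops_def proj_ops_def mk_op_in_operations)

text \<open>Division and remainder by zero on \<^typ>\<open>nat\<close> follow the intended
  conventions, and subtraction is truncated.\<close>

lemma "(x :: nat) div 0 = 0" "(x :: nat) mod 0 = x" "(x :: nat) mod y = x - y * (x div y)"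
  by (simp_all add: minus_mult_div_eq_mod)

end

theory Submission
  imports Defs "HOL-Number_Theory.Cong"
begin

text \<open>
  The inclusion from left to right is routine. For the converse one shows that the superpositions of
  addition, remainder and \<open>2\<^sup>x\<close> are closed under bounded sums and products. Subtraction,
  multiplication, division and powers are obtained by computing modulo suitable numbers; the greatest
  common divisor and the binomial coefficients appear as digits of products of geometric sums and of
  powers, whence the 2-adic valuation and, by Kummer, the Hamming weight
  \<open>\<nu>\<^sub>2(2n choose n)\<close> of \<open>n\<close>. Packing the values of a nonnegative exponential polynomial on
  a box into the blocks of one number, which is a combination of sums \<open>\<Sum> a\<^sup>n q\<^sup>a\<close>, the number of
  its zeros is read off a Hamming weight.

  The packed number \<open>\<Sum>z<y. f z * 2\<^sup>w\<^sup>z\<close> is then expressible for every superposition \<open>f\<close>, by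
  induction on \<open>f\<close>: for \<open>f = g mod h\<close> and \<open>f = 2\<^sup>g\<close> it is the number of solutions of a fixed
  exponential equation whose parameters are the packed numbers of \<open>g\<close> and \<open>h\<close>. The
  case \<open>w = 0\<close> is the bounded sum, and bounded products count digit strings.
\<close>

section \<open>Arithmetic from addition, remainder and powers of two\<close>

text \<open>Functions of an infinite environment \<open>e\<close> replace operations of fixed arity,
  so that substitution is composition and a bound variable is an update \<open>e(k := z)\<close>.
  Arities return with \<open>ame_ops\<close>.\<close>

inductive ame :: "((nat \<Rightarrow> nat) \<Rightarrow> nat) \<Rightarrow> bool" where
  const: "ame (\<lambda>e. c)"
| var: "ame (\<lambda>e. e i)"
| add: "ame f \<Longrightarrow> ame g \<Longrightarrow> ame (\<lambda>e. f e + g e)"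
| mod: "ame f \<Longrightarrow> ame g \<Longrightarrow> ame (\<lambda>e. f e mod g e)"
| exp2: "ame f \<Longrightarrow> ame (\<lambda>e. 2 ^ f e)"

named_theorems ame_intros
declare ame.intros [ame_intros]

lemma ame_cong: "ame g \<Longrightarrow> (\<And>e. f e = g e) \<Longrightarrow> ame f"
  by (metis ext)

lemma ame_subst:
  assumes "ame f" "\<And>i. ame (g i)"
  shows "ame (\<lambda>e. f (\<lambda>i. g i e))"
  using assms(1) by induction (auto intro: ame.intros assms(2))

text \<open>Put \<open>N = 2 ^ (x + y)\<close>. For \<open>0 < y <= x\<close> the inner remainder is
  \<open>N - y\<close>, and adding \<open>x\<close> modulo \<open>N\<close> leaves
  \<open>x - y\<close>. The last modulus is a switch: it is 0, which changes nothing, if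
  \<open>y <= x\<close>, and 1, which gives 0, otherwise.\<close>

lemma diff_eq_mod:
  fixes x y :: nat
  shows "x - y = ((x + 2 ^ (x + y + 1) mod (2 ^ (x + y) + y)) mod 2 ^ (x + y)) mod
                 (1 mod (2 ^ x mod 2 ^ y + 1))"
proof (cases "y \<le> x")
  case True
  define N :: nat where "N = 2 ^ (x + y)"
  have N: "x + y < N"
    unfolding N_def by (rule less_exp)
  have "(2::nat) ^ x mod 2 ^ y = 0"
    using True by (simp add: le_imp_power_dvd)
  moreover have "(x + 2 * N mod (N + y)) mod N = x - y"
  proof (cases "y = 0")
    case True
    then show ?thesis
      using N by simp
  next
    case False
    have "2 * N mod (N + y) = N - y"
      using N False by (subst le_mod_geq) auto
    then have "(x + 2 * N mod (N + y)) mod N = (x - y + N) mod N"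
      using True N by simp
    then show ?thesis
      using N by simp
  qed
  ultimately show ?thesis
    by (simp add: N_def)
next
  case False
  then have "(2::nat) ^ x mod 2 ^ y = 2 ^ x"
    by simp
  then show ?thesis
    using False by simp
qed

lemma ame_diff [ame_intros]:
  assumes "ame f" "ame g"
  shows "ame (\<lambda>e. f e - g e)"
  unfolding diff_eq_mod by (intro ame_intros assms)

lemma cong_mod_diff: "x \<le> a \<Longrightarrow> [a = x] (mod (a - x))" for a x :: nat
  unfolding cong_def by (metis le_add_diff_inverse2 mod_add_self1)

text \<open>Modulo \<open>2 ^ k - x\<close> one may replace \<open>2 ^ k\<close> by
  \<open>x\<close>, and the hypothesis makes \<open>x ^ n\<close> smaller than this modulus.\<close>

lemma power_mod_diff:
  fixes x k n :: nat
  assumes "x ^ n + x < 2 ^ k"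
  shows "2 ^ (k * n) mod (2 ^ k - x) = x ^ n"
proof -
  have "[2 ^ k = x] (mod (2 ^ k - x))"
    using assms by (intro cong_mod_diff) simp
  then have "[(2 ^ k) ^ n = x ^ n] (mod (2 ^ k - x))"
    by (rule cong_pow)
  then have "2 ^ (k * n) mod (2 ^ k - x) = x ^ n mod (2 ^ k - x)"
    by (simp add: cong_def power_mult)
  then show ?thesis
    using assms by simp
qed

text \<open>This is \<open>power_mod_diff\<close> for \<open>k = x + x + 2\<close>. The exponents
  are written as sums because products are not yet available to \<open>ame\<close>.\<close>

lemma square_eq_mod: "x ^ 2 = 2 ^ (x + x + x + x + 4) mod (2 ^ (x + x + 2) - x)" for x :: nat
proof -
  have "x ^ 2 \<le> (2 ^ x) ^ 2"
    by (intro power_mono less_imp_le[OF less_exp]) auto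
  moreover have "x \<le> 2 ^ x" "(2::nat) ^ x \<le> (2 ^ x) ^ 2"
    by (auto intro: less_imp_le[OF less_exp] self_le_power)
  moreover have "(2::nat) ^ x > 0"
    by simp
  ultimately have "x ^ 2 + x < 4 * (2 ^ x) ^ 2"
    by linarith
  then have "x ^ 2 + x < 2 ^ (x + x + 2)"
    by (simp add: power_add power2_eq_square)
  moreover have "(x + x + 2) * 2 = x + x + x + x + 4"
    by simp
  ultimately show ?thesis
    using power_mod_diff by metis
qed

lemma ame_square:
  assumes "ame f"
  shows "ame (\<lambda>e. f e ^ 2)"
  unfolding square_eq_mod by (intro ame_intros assms)

text \<open>Recovers a product from its double, which is all that squares provide: the right side
  depends on \<open>n\<close> only through \<open>2 * n\<close>. The difference of squares equals
  \<open>n * 2 ^ (2 * n + 2)\<close>, and that power of two is 1 modulo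
  \<open>2 ^ (2 * n + 2) - 1\<close>.\<close>

lemma half_eq_mod:
  fixes n :: nat
  shows "n = ((2 * n + 2 ^ (2 * n)) ^ 2 - (2 * n) ^ 2 - (2 ^ (2 * n)) ^ 2) mod (2 ^ (2 * n + 2) - 1)"
proof -
  have "(a + b) ^ 2 - a ^ 2 - b ^ 2 = 2 * a * b" for a b :: nat
    by (simp add: power2_sum)
  from this[of "2 * n" "2 ^ (2 * n)"]
  have "(2 * n + 2 ^ (2 * n)) ^ 2 - (2 * n) ^ 2 - (2 ^ (2 * n)) ^ 2 = n * 2 ^ (2 * n + 2)"
    by (simp only: power_add) simp
  moreover have "[2 ^ (2 * n + 2) = 1] (mod (2 ^ (2 * n + 2) - 1 :: nat))"
    by (intro cong_mod_diff) simp
  then have "[n * 2 ^ (2 * n + 2) = n * 1] (mod (2 ^ (2 * n + 2) - 1 :: nat))"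
    by (rule cong_scalar_left)
  moreover have "n < 2 ^ (2 * n + 2) - 1"
  proof -
    have "2 * n + 2 < 2 ^ (2 * n + 2)"
      by (rule less_exp)
    then show ?thesis by linarith
  qed
  ultimately show ?thesis
    by (simp add: cong_def)
qed

lemma ame_mult [ame_intros]:
  assumes "ame f" "ame g"
  shows "ame (\<lambda>e. f e * g e)"
proof -
  have *: "2 * (f e * g e) = (f e + g e) ^ 2 - f e ^ 2 - g e ^ 2" for e
    by (simp add: power2_sum)
  show ?thesis
    by (rule ame_cong[OF _ half_eq_mod], unfold *) (intro ame_intros ame_square assms)
qed

text \<open>Exact division is multiplication by an inverse: \<open>x - x mod y\<close> is
  \<open>q * y\<close>, and \<open>K = q * y + 2\<close> inverts \<open>y\<close> modulo
  \<open>y * K - 1\<close>, which exceeds \<open>q\<close>. For \<open>y = 0\<close> both sides are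
  0.\<close>

lemma div_eq_mod:
  fixes x y :: nat
  shows "x div y = ((x - x mod y) * (x - x mod y + 2)) mod (y * (x - x mod y + 2) - 1)"
proof (cases "y = 0")
  case False
  define q where "q = x div y"
  have n: "x - x mod y = q * y"
    by (simp add: q_def minus_mod_eq_div_mult)
  define K where "K = q * y + 2"
  have "[y * K = 1] (mod (y * K - 1))"
    using False by (intro cong_mod_diff) (simp add: K_def)
  then have "[q * (y * K) = q * 1] (mod (y * K - 1))"
    by (rule cong_scalar_left)
  moreover have "q < y * K - 1"
  proof -
    have "q \<le> q * y" "1 * K \<le> y * K"
      using False by auto
    moreover have "1 * K = q * y + 2"
      by (simp add: K_def)
    ultimately show ?thesis
      by linarith
  qed
  ultimately show ?thesis
    unfolding n K_def[symmetric] by (simp only: cong_def mod_less mult_1_right mult.assoc q_def)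
qed simp

lemma ame_div [ame_intros]:
  assumes "ame f" "ame g"
  shows "ame (\<lambda>e. f e div g e)"
  unfolding div_eq_mod by (intro ame_intros assms)

lemma power_eq_mod: "x ^ n = 2 ^ ((x * n + x + 1) * n) mod (2 ^ (x * n + x + 1) - x)" for x n :: nat
proof -
  have "x ^ n \<le> (2 ^ x) ^ n"
    by (intro power_mono less_imp_le[OF less_exp]) auto
  then have "x ^ n + x < (2 ^ x) ^ n + 2 ^ x"
    using less_exp[of x] by linarith
  also have "\<dots> \<le> 2 ^ (x * n + x) + 2 ^ (x * n + x)"
    by (intro add_mono) (simp_all add: power_mult[symmetric] power_increasing)
  finally have "x ^ n + x < 2 ^ (x * n + x + 1)"
    by simp
  from power_mod_diff[OF this] show ?thesis
    by simp
qed

lemma ame_power [ame_intros]: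
  assumes "ame f" "ame g"
  shows "ame (\<lambda>e. f e ^ g e)"
  by (rule ame_cong[OF _ power_eq_mod]) (intro ame_intros assms)

lemma ame_sum [ame_intros]:
  assumes "\<And>j. j \<in> J \<Longrightarrow> ame (f j)"
  shows "ame (\<lambda>e. \<Sum>j\<in>J. f j e)"
  using assms by (induction J rule: infinite_finite_induct) (simp_all add: ame.const ame.add)

lemma ame_prod [ame_intros]:
  assumes "\<And>j. j \<in> J \<Longrightarrow> ame (f j)"
  shows "ame (\<lambda>e. \<Prod>j\<in>J. f j e)"
  using assms by (induction J rule: infinite_finite_induct) (simp_all add: ame.const ame_mult)

section \<open>Greatest common divisors and Hamming weights\<close>

lemma digit_sum_less:
  fixes c :: "nat \<Rightarrow> nat"
  assumes "\<And>k. k < m \<Longrightarrow> c k < X"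
  shows "(\<Sum>k<m. c k * X ^ k) < X ^ m"
  using assms
proof (induction m)
  case (Suc m)
  then have "(\<Sum>k<m. c k * X ^ k) < X ^ m" "c m + 1 \<le> X"
    by (auto simp: Suc_le_eq)
  moreover from this(2) have "(c m + 1) * X ^ m \<le> X * X ^ m"
    by (rule mult_right_mono) simp
  ultimately show ?case
    by simp
qed simp

lemma digit_sum_split:
  fixes c :: "nat \<Rightarrow> nat"
  assumes "m < L"
  obtains hi where
    "(\<Sum>k<L. c k * X ^ k) = (\<Sum>k<m. c k * X ^ k) + c m * X ^ m + hi * X * X ^ m"
proof -
  define hi where "hi = (\<Sum>k<L - Suc m. c (k + Suc m) * X ^ k)"
  have "(\<Sum>k<L. c k * X ^ k) = (\<Sum>k<m. c k * X ^ k) + (\<Sum>k=m..<L. c k * X ^ k)"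
    using sum.atLeastLessThan_concat[of 0 m L "\<lambda>k. c k * X ^ k"] assms
    by (simp add: lessThan_atLeast0)
  also have "(\<Sum>k=m..<L. c k * X ^ k) = c m * X ^ m + (\<Sum>k=Suc m..<L. c k * X ^ k)"
    by (rule sum.atLeast_Suc_lessThan[OF assms])
  also have "(\<Sum>k=Suc m..<L. c k * X ^ k) = (\<Sum>k<L - Suc m. c (k + Suc m) * X ^ (k + Suc m))"
    using assms by (intro sum.reindex_bij_witness[of _ "\<lambda>k. k + Suc m" "\<lambda>k. k - Suc m"]) auto
  also have "\<dots> = hi * X * X ^ m"
    by (simp add: hi_def sum_distrib_right sum_distrib_left power_add mult_ac)
  finally show ?thesis
    by (intro that[of hi]) simp
qed

lemma digit_sum_nth:
  fixes c :: "nat \<Rightarrow> nat"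
  assumes "\<And>k. k < L \<Longrightarrow> c k < X" "m < L"
  shows "(\<Sum>k<L. c k * X ^ k) div X ^ m mod X = c m"
proof -
  obtain hi where hi: "(\<Sum>k<L. c k * X ^ k) = (\<Sum>k<m. c k * X ^ k) + c m * X ^ m + hi * X * X ^ m"
    using digit_sum_split[OF assms(2), of c X] by metis
  have "(\<Sum>k<m. c k * X ^ k) < X ^ m"
    using assms by (intro digit_sum_less) auto
  then have "((\<Sum>k<m. c k * X ^ k) + (c m + hi * X) * X ^ m) div X ^ m = c m + hi * X"
    by (metis add.right_neutral div_less div_mult_self3 gr_implies_not0 add.commute)
  moreover have "(\<Sum>k<L. c k * X ^ k) = (\<Sum>k<m. c k * X ^ k) + (c m + hi * X) * X ^ m"
    by (simp add: hi distrib_right)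
  ultimately show ?thesis
    using assms by simp
qed

lemma geometric_sum_nat: "(\<Sum>i<n. q ^ i) = (q ^ n - 1) div (q - 1)" if "q \<ge> 2" for q :: nat
proof -
  obtain r where "q = Suc r"
    using \<open>q \<ge> 2\<close> by (cases q) auto
  then have "(q - 1) * (\<Sum>i<n. q ^ i) + 1 = q ^ n"
    by (induction n) (simp_all add: algebra_simps)
  then have "q ^ n - 1 = (q - 1) * (\<Sum>i<n. q ^ i)"
    by simp
  then show ?thesis
    using that by simp
qed

text \<open>Write \<open>x = g * a\<close> and \<open>y = g * b\<close> with \<open>a\<close>,
  \<open>b\<close> coprime. The equation forces \<open>b\<close> to divide the first coordinate, so
  the solutions are \<open>(t * b, (g - t) * a)\<close> with \<open>t = 0, ..., g\<close>.\<close>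

lemma card_lattice_points:
  fixes x y :: nat
  assumes "x > 0" "y > 0"
  shows "card {p \<in> {..y} \<times> {..x}. x * fst p + y * snd p = x * y} = gcd x y + 1"
proof -
  define g where "g = gcd x y"
  obtain a b where ab: "x = g * a" "y = g * b" "coprime a b"
    using gcd_coprime_exists[of x y] assms unfolding g_def by (auto simp: mult.commute)
  have pos: "g > 0" "a > 0" "b > 0"
    using ab assms by auto
  have "{p \<in> {..y} \<times> {..x}. x * fst p + y * snd p = x * y} = (\<lambda>t. (t * b, (g - t) * a)) ` {..g}"
    (is "?L = ?R")
  proof (intro equalityI subsetI)
    fix p assume "p \<in> ?L"
    then obtain i j where p: "p = (i, j)" "i \<le> y" "j \<le> x" and eq: "x * i + y * j = x * y"
      by auto
    have "a * i + b * j = g * a * b"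
    proof -
      have "g * (a * i + b * j) = g * (g * a * b)"
        using eq unfolding ab(1,2) by (simp add: algebra_simps)
      then show ?thesis using pos by simp
    qed
    then have "b dvd a * i"
      by (metis dvd_add_left_iff dvd_triv_left dvd_triv_right)
    then obtain t where t: "i = t * b"
      using ab(3) by (metis coprime_commute coprime_dvd_mult_right_iff dvdE mult.commute)
    have "t \<le> g"
      using p(2) pos unfolding t ab(2) by simp
    have "b * (t * a + j) = b * (g * a)"
      using \<open>a * i + b * j = g * a * b\<close> unfolding t by (simp add: algebra_simps)
    then have "j = (g - t) * a"
      using pos by (simp add: diff_mult_distrib)
    then show "p \<in> ?R"
      using \<open>t \<le> g\<close> p t by auto
  next
    fix p assume "p \<in> ?R"
    then obtain t where t: "t \<le> g" "p = (t * b, (g - t) * a)"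
      by auto
    then obtain s where s: "g = t + s"
      using le_Suc_ex by blast
    show "p \<in> ?L"
      unfolding t ab(1,2) by (auto simp: s algebra_simps)
  qed
  moreover have "inj_on (\<lambda>t. (t * b, (g - t) * a)) {..g}"
    using pos by (auto intro: inj_onI)
  ultimately show ?thesis
    by (simp add: card_image g_def)
qed

text \<open>The coefficient of \<open>X\<^sup>x\<^sup>y\<close> in
  \<open>(1 + X\<^sup>x + \<dots> + X\<^sup>x\<^sup>y) (1 + X\<^sup>y + \<dots> + X\<^sup>x\<^sup>y)\<close> is \<open>gcd x y + 1\<close>; the coefficients are digits
  in base \<open>X\<close>.\<close>

lemma gcd_eq_digit:
  fixes x y :: nat
  assumes "x > 0" "y > 0"
  defines "X \<equiv> 2 ^ (x + y + 2)"
  shows "gcd x y = ((X ^ x) ^ (y + 1) - 1) div (X ^ x - 1) * (((X ^ y) ^ (x + 1) - 1) div (X ^ y - 1))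
     div X ^ (x * y) mod X - 1"
proof -
  let ?S = "{..y} \<times> {..x}"
  define c where "c k = card {p \<in> ?S. x * fst p + y * snd p = k}" for k
  \<comment> \<open>No carries occur: a coefficient is at most the number
    \<open>(y + 1) * (x + 1)\<close> of pairs of terms, which is below the base.\<close>
  have c: "c k < X" for k
  proof -
    have "c k \<le> card ?S"
      unfolding c_def by (intro card_mono) auto
    also have "card ?S = (y + 1) * (x + 1)"
      by (simp add: card_cartesian_product)
    also have "\<dots> < 2 ^ (y + 1) * 2 ^ (x + 1)"
      by (intro mult_strict_mono less_exp) auto
    finally show ?thesis
      by (simp add: X_def power_add mult.commute)
  qed
  have X: "X ^ n \<ge> 2" if "n > 0" for n
  proof -
    have "(2::nat) ^ 1 \<le> 2 ^ (x + y + 2)"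
      by (rule power_increasing) simp_all
    then have "(2::nat) ^ 1 \<le> X ^ 1"
      by (simp only: X_def power_one_right)
    also have "\<dots> \<le> X ^ n"
      using that by (intro power_increasing) (auto simp: X_def)
    finally show ?thesis by simp
  qed
  have "((X ^ x) ^ (y + 1) - 1) div (X ^ x - 1) * (((X ^ y) ^ (x + 1) - 1) div (X ^ y - 1)) =
     (\<Sum>i<y + 1. (X ^ x) ^ i) * (\<Sum>j<x + 1. (X ^ y) ^ j)"
    using X assms by (simp only: geometric_sum_nat)
  also have "\<dots> = (\<Sum>(i, j)\<in>?S. X ^ (x * i + y * j))"
    by (simp add: sum_product sum.cartesian_product power_add power_mult lessThan_Suc_atMost)
  also have "\<dots> = (\<Sum>k<2 * x * y + 1. \<Sum>p\<in>{p \<in> ?S. x * fst p + y * snd p = k}. X ^ (x * fst p + y * snd p))"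
  proof (subst sum.group)
    show "(\<lambda>p. x * fst p + y * snd p) ` ?S \<subseteq> {..<2 * x * y + 1}"
    proof clarsimp
      fix i j assume "i \<le> y" "j \<le> x"
      then have "x * i \<le> x * y" "y * j \<le> y * x"
        by simp_all
      then show "x * i + y * j < Suc (2 * x * y)"
        by (simp only: mult.commute[of y x] mult.assoc)
    qed
  qed (auto simp: case_prod_unfold)
  also have "\<dots> = (\<Sum>k<2 * x * y + 1. c k * X ^ k)"
    by (simp add: c_def)
  finally have *: "((X ^ x) ^ (y + 1) - 1) div (X ^ x - 1) * (((X ^ y) ^ (x + 1) - 1) div (X ^ y - 1)) =
     (\<Sum>k<2 * x * y + 1. c k * X ^ k)" .
  show ?thesis
    unfolding * using card_lattice_points[OF assms(1,2)]
    by (subst digit_sum_nth[OF c]) (auto simp: c_def)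
qed

lemma ame_gcd:
  assumes "ame f" "ame g" "\<And>e. f e > 0" "\<And>e. g e > 0"
  shows "ame (\<lambda>e. gcd (f e) (g e))"
  by (rule ame_cong[OF _ gcd_eq_digit]) (intro ame_intros assms)+

text \<open>With \<open>v\<close> the valuation and \<open>M = 2 ^ (m + 2) - 1\<close>, the gcd is
  \<open>2 ^ v\<close> because \<open>v < m\<close>, and its power is \<open>(M + 1) ^ v\<close>.
  Modulo \<open>M ^ 2\<close> only the linear part \<open>1 + v * M\<close> survives, from which
  \<open>v\<close> is read off.\<close>

lemma multiplicity_2_eq:
  fixes m :: nat
  assumes "m > 0"
  shows "multiplicity 2 m =
    (gcd m (2 ^ m) ^ (m + 2) mod (2 ^ (m + 2) - 1) ^ 2 - 1) div (2 ^ (m + 2) - 1)"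
proof -
  define v where "v = multiplicity 2 m"
  obtain k where k: "m = 2 ^ v * k" "\<not> 2 dvd k"
    using multiplicity_decompose'[of m 2] assms unfolding v_def by auto
  have "2 ^ v \<le> m"
    using k assms by (simp add: dvd_imp_le)
  then have v: "v < m"
    using less_exp[of v] by linarith
  have "gcd (2 ^ v * k) (2 ^ v * 2 ^ (m - v)) = 2 ^ v * gcd k (2 ^ (m - v))"
    by (simp add: gcd_mult_distrib_nat)
  also have "gcd k (2 ^ (m - v)) = 1"
    using k(2) by (metis coprime_iff_gcd_eq_1 coprime_power_right_iff coprime_right_2_iff_odd)
  finally have gcd: "gcd m (2 ^ m) = 2 ^ v"
    using v k(1) by (simp add: power_add[symmetric])
  define M :: nat where "M = 2 ^ (m + 2) - 1"
  have M: "2 ^ (m + 2) = M + 1"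
    by (simp add: M_def)
  have "\<exists>t. (M + 1) ^ n = 1 + n * M + t * M ^ 2" for n
  proof (induction n)
    case (Suc n)
    then obtain t where t: "(M + 1) ^ n = 1 + n * M + t * M ^ 2" by blast
    show ?case
      by (rule exI[of _ "n + t + t * M"])
        (simp only: power_Suc t, simp add: power2_eq_square algebra_simps)
  qed simp
  then obtain t where t: "(M + 1) ^ v = 1 + v * M + t * M ^ 2"
    by blast
  have "m + 2 < M + 1"
    unfolding M[symmetric] by (rule less_exp)
  then have "v + 1 < M" "M \<ge> 1"
    using v by simp_all
  then have "(v + 1) * M < M * M"
    by (intro mult_strict_right_mono) simp_all
  then have "1 + v * M < M ^ 2"
    using \<open>M \<ge> 1\<close> by (simp add: power2_eq_square)
  have "gcd m (2 ^ m) ^ (m + 2) = (M + 1) ^ v"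
    unfolding gcd M[symmetric] by (simp only: power_mult[symmetric] mult.commute)
  then have "gcd m (2 ^ m) ^ (m + 2) mod M ^ 2 = 1 + v * M"
    using \<open>1 + v * M < M ^ 2\<close> unfolding t by simp
  then show ?thesis
    using \<open>M \<ge> 1\<close> unfolding M_def[symmetric] v_def[symmetric] by simp
qed

lemma ame_multiplicity_2:
  assumes "ame f" "\<And>e. f e > 0"
  shows "ame (\<lambda>e. multiplicity 2 (f e))"
  by (rule ame_cong[OF _ multiplicity_2_eq]) (intro ame_intros ame_gcd assms zero_less_power zero_less_numeral)+

section \<open>Hamming weights of numbers and of packed blocks\<close>

fun hamming_weight :: "nat \<Rightarrow> nat" where
  "hamming_weight n = (if n = 0 then 0 else n mod 2 + hamming_weight (n div 2))"

declare hamming_weight.simps [simp del]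

lemma hamming_weight_0 [simp]: "hamming_weight 0 = 0"
  by (simp add: hamming_weight.simps)

lemma hamming_weight_double [simp]: "hamming_weight (2 * n) = hamming_weight n"
  by (subst hamming_weight.simps) auto

lemma hamming_weight_Suc_double [simp]: "hamming_weight (Suc (2 * n)) = Suc (hamming_weight n)"
  by (subst hamming_weight.simps) auto

text \<open>Adding 1 clears the trailing ones of \<open>n\<close>, whose number is the valuation of
  \<open>Suc n\<close>, and sets the zero above them.\<close>

lemma hamming_weight_Suc: "hamming_weight (Suc n) + multiplicity 2 (Suc n) = Suc (hamming_weight n)"
proof (induction n rule: less_induct)
  case (less n)
  show ?case
  proof (cases "even n")
    case True
    then obtain m where "n = 2 * m" by blast
    then show ?thesis
      by (simp add: not_dvd_imp_multiplicity_0)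
  next
    case False
    then obtain m where n: "n = Suc (2 * m)"
      using oddE by (metis Suc_eq_plus1)
    have "multiplicity 2 (2 * Suc m) = Suc (multiplicity 2 (Suc m))"
      by (rule multiplicity_times_same) auto
    moreover have "Suc n = 2 * Suc m"
      by (simp add: n)
    moreover have "hamming_weight (Suc n) = hamming_weight (Suc m)"
      unfolding \<open>Suc n = 2 * Suc m\<close> by (rule hamming_weight_double)
    ultimately show ?thesis
      using less[of m] by (simp add: n)
  qed
qed

text \<open>Both sides satisfy the same recursion. The step from \<open>n\<close> to
  \<open>Suc n\<close> multiplies the central binomial coefficient by
  \<open>2 * (2 * n + 1) / (n + 1)\<close>, which changes its valuation by 1 minus that of
  \<open>n + 1\<close>; compare \<open>hamming_weight_Suc\<close>.\<close>

lemma hamming_weight_eq_multiplicity: "hamming_weight n = multiplicity 2 (2 * n choose n)"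
proof (induction n)
  case (Suc n)
  have "(2 * Suc n choose Suc n) * Suc n = 2 * Suc (2 * n) * (2 * n choose n)"
  proof -
    have "Suc n * (2 * Suc n choose Suc n) = 2 * Suc n * (Suc (2 * n) choose n)"
      using Suc_times_binomial_eq[of "Suc (2 * n)" n] by simp
    moreover have "Suc n * (Suc (2 * n) choose n) = Suc (2 * n) * (2 * n choose n)"
      using binomial_absorb_comp[of "Suc (2 * n)" n] by (simp add: Suc_diff_le)
    ultimately show ?thesis
      by (simp add: mult_ac)
  qed
  moreover have "(2 * n choose n) > 0" "(2 * Suc n choose Suc n) > 0"
    by (auto simp: zero_less_binomial_iff)
  ultimately have "multiplicity 2 (2 * Suc n choose Suc n) + multiplicity 2 (Suc n) =
      multiplicity 2 (2 * Suc (2 * n)) + multiplicity 2 (2 * n choose n)"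
    by (metis Zero_not_Suc mult_eq_0_iff prime_elem_multiplicity_mult_distrib two_is_prime_nat
        prime_imp_prime_elem zero_neq_numeral not_gr_zero)
  moreover have "multiplicity 2 (2 * Suc (2 * n)) = 1"
    by (subst multiplicity_times_same) (auto simp: not_dvd_imp_multiplicity_0)
  ultimately show ?case
    using hamming_weight_Suc[of n] Suc by simp
qed simp

text \<open>The binomial coefficients are the digits of \<open>(1 + X) ^ (2 * n)\<close> in base
  \<open>X = 2 ^ (2 * n + 1)\<close>, since each is at most \<open>2 ^ (2 * n)\<close>.\<close>

lemma central_binomial_eq: "(2 * n choose n) = (1 + 2 ^ (2 * n + 1)) ^ (2 * n) div (2 ^ (2 * n + 1)) ^ n mod 2 ^ (2 * n + 1)"
proof -
  have "(1 + (2::nat) ^ (2 * n + 1)) ^ (2 * n) = (\<Sum>k<2 * n + 1. (2 * n choose k) * (2 ^ (2 * n + 1)) ^ k)"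
    by (subst add.commute, subst binomial) (simp add: lessThan_Suc_atMost)
  moreover have "(2 * n choose k) < 2 ^ (2 * n + 1)" for k
  proof -
    have "(2 * n choose k) \<le> 2 ^ (2 * n)"
      by (rule binomial_le_pow2)
    also have "\<dots> < 2 ^ (2 * n + 1)"
      by simp
    finally show ?thesis .
  qed
  ultimately show ?thesis
    by (simp only:) (rule digit_sum_nth[symmetric], auto)
qed

lemma ame_hamming_weight [ame_intros]:
  assumes "ame f"
  shows "ame (\<lambda>e. hamming_weight (f e))"
proof -
  have "ame (\<lambda>e. 2 * f e choose f e)"
    by (rule ame_cong[OF _ central_binomial_eq]) (intro ame_intros assms)
  then show ?thesis
    unfolding hamming_weight_eq_multiplicity
    by (intro ame_multiplicity_2) (auto simp: zero_less_binomial_iff)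
qed

lemma hamming_weight_append:
  "a < 2 ^ k \<Longrightarrow> hamming_weight (a + b * 2 ^ k) = hamming_weight a + hamming_weight b"
proof (induction k arbitrary: a)
  case (Suc k)
  have "a div 2 < 2 ^ k"
    using Suc.prems by (simp add: less_mult_imp_div_less mult.commute)
  note IH = Suc.IH[OF this]
  show ?case
  proof (cases "even a")
    case True
    then obtain c where "a = 2 * c" by blast
    then show ?thesis
      using IH hamming_weight_double[of "c + b * 2 ^ k"] by (simp add: distrib_left mult.left_commute)
  next
    case False
    then obtain c where "a = Suc (2 * c)"
      using oddE by (metis Suc_eq_plus1)
    then show ?thesis
      using IH hamming_weight_Suc_double[of "c + b * 2 ^ k"] by (simp add: distrib_left mult.left_commute)
  qed
qed simp

text \<open>Subtraction from \<open>2 ^ w - 1\<close> flips all \<open>w\<close> bits.\<close>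

lemma hamming_weight_complement:
  "q < 2 ^ w \<Longrightarrow> hamming_weight (2 ^ w - 1 - q) + hamming_weight q = w"
proof (induction w arbitrary: q)
  case (Suc w)
  have less: "q div 2 < 2 ^ w"
    using Suc.prems by (simp add: less_mult_imp_div_less mult.commute)
  note IH = Suc.IH[OF less]
  show ?case
  proof (cases "even q")
    case True
    then obtain c where c: "q = 2 * c" by blast
    then have "2 ^ Suc w - 1 - q = Suc (2 * (2 ^ w - 1 - c))"
      using less by simp
    then show ?thesis
      using IH c by (simp only: hamming_weight_Suc_double) simp
  next
    case False
    then obtain c where c: "q = Suc (2 * c)"
      using oddE by (metis Suc_eq_plus1)
    then have "2 ^ Suc w - 1 - q = 2 * (2 ^ w - 1 - c)"
      by simp
    then show ?thesis
      using IH c by (simp only: hamming_weight_double) simp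
  qed
qed simp

text \<open>Multiplication by \<open>2\<^sup>w - 1\<close> turns the question whether a block is nonzero into a Hamming weight.\<close>

lemma hamming_weight_mult_mersenne:
  assumes "p \<le> 2 ^ w"
  shows "hamming_weight ((2 ^ w - 1) * p) = (if p = 0 then 0 else w)"
proof (cases p)
  case (Suc q)
  have "(2 ^ w - 1) * p = (2 ^ w - 1 - q) + q * 2 ^ w"
    using assms unfolding Suc by (simp add: algebra_simps)
  then show ?thesis
    using assms Suc hamming_weight_complement[of q w] hamming_weight_append[of "2 ^ w - 1 - q" w q]
    by simp
qed simp

text \<open>Blocks of \<open>k\<close> bits at distinct positions do not overlap. In the induction
  the largest position comes last, so that its block lies above the whole earlier sum.\<close>

lemma hamming_weight_sum:
  assumes "finite S" "\<And>t. t \<in> S \<Longrightarrow> c t < 2 ^ k"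
  shows "hamming_weight (\<Sum>t\<in>S. c t * 2 ^ (k * t)) = (\<Sum>t\<in>S. hamming_weight (c t))"
  using assms
proof (induction S rule: finite_linorder_max_induct)
  case (insert m S)
  have "(\<Sum>t\<in>S. c t * 2 ^ (k * t)) < 2 ^ (k * m)"
  proof -
    have "(\<Sum>t\<in>S. c t * 2 ^ (k * t)) = (\<Sum>t<m. (if t \<in> S then c t else 0) * (2 ^ k) ^ t)"
      using insert.hyps by (intro sum.mono_neutral_cong_left) (auto simp: power_mult)
    also have "\<dots> < (2 ^ k) ^ m"
      using insert.prems by (intro digit_sum_less) auto
    finally show ?thesis
      by (simp add: power_mult)
  qed
  then have "hamming_weight ((\<Sum>t\<in>S. c t * 2 ^ (k * t)) + c m * 2 ^ (k * m)) =
      hamming_weight (\<Sum>t\<in>S. c t * 2 ^ (k * t)) + hamming_weight (c m)"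
    by (rule hamming_weight_append)
  then show ?case
    using insert by (auto simp: add.commute)
qed simp

lemma hamming_weight_sum_inj:
  assumes "finite S" "inj_on t S" "\<And>a. a \<in> S \<Longrightarrow> c a < 2 ^ k"
  shows "hamming_weight (\<Sum>a\<in>S. c a * 2 ^ (k * t a)) = (\<Sum>a\<in>S. hamming_weight (c a))"
proof -
  have "(\<Sum>a\<in>S. c a * 2 ^ (k * t a)) = (\<Sum>x\<in>t ` S. c (inv_into S t x) * 2 ^ (k * x))"
    using assms(2) by (simp add: sum.reindex)
  also have "hamming_weight \<dots> = (\<Sum>x\<in>t ` S. hamming_weight (c (inv_into S t x)))"
    using assms by (intro hamming_weight_sum) (auto simp: inv_into_into)
  also have "\<dots> = (\<Sum>a\<in>S. hamming_weight (c a))"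
    using assms(2) by (simp add: sum.reindex)
  finally show ?thesis .
qed

section \<open>Counting solutions of exponential polynomial equations\<close>

text \<open>Shifting the index in the sum changes it only by its end terms
  \<open>M ^ n * q ^ M\<close> and \<open>0 ^ n\<close>, the latter being 1 only for
  \<open>n = 0\<close>. Expanding \<open>(a + 1) ^ n\<close> in the shifted sum and solving for the
  sum with exponent \<open>n\<close> leaves the factor \<open>q - 1\<close>.\<close>

lemma power_sum_recurrence:
  fixes q :: nat
  assumes "q \<ge> 2"
  shows "(\<Sum>a<M. a ^ n * q ^ a) =
    (M ^ n * q ^ M - 0 ^ n - q * (\<Sum>j<n. (n choose j) * (\<Sum>a<M. a ^ j * q ^ a))) div (q - 1)"
proof -
  define S where "S j = (\<Sum>a<M. a ^ j * q ^ a)" for j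
  have "(\<Sum>a<M. (a + 1) ^ n * q ^ (a + 1)) + 0 ^ n = M ^ n * q ^ M + S n"
    unfolding S_def by (induction M) auto
  moreover have "(\<Sum>a<M. (a + 1) ^ n * q ^ (a + 1)) = q * (\<Sum>j\<le>n. (n choose j) * S j)"
  proof -
    have "(\<Sum>a<M. (a + 1) ^ n * q ^ (a + 1)) = (\<Sum>a<M. \<Sum>j\<le>n. q * ((n choose j) * (a ^ j * q ^ a)))"
    proof (rule sum.cong[OF refl])
      fix a
      have "(a + 1) ^ n = (\<Sum>j\<le>n. (n choose j) * a ^ j)"
        using binomial[of a 1 n] by simp
      then show "(a + 1) ^ n * q ^ (a + 1) = (\<Sum>j\<le>n. q * ((n choose j) * (a ^ j * q ^ a)))"
        by (simp add: sum_distrib_right sum_distrib_left mult_ac)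
    qed
    also have "\<dots> = (\<Sum>j\<le>n. \<Sum>a<M. q * ((n choose j) * (a ^ j * q ^ a)))"
      by (rule sum.swap)
    finally show ?thesis
      by (simp add: S_def sum_distrib_left)
  qed
  moreover have "(\<Sum>j\<le>n. (n choose j) * S j) = (\<Sum>j<n. (n choose j) * S j) + S n"
    by (simp add: lessThan_Suc_atMost[symmetric])
  ultimately have "q * (\<Sum>j<n. (n choose j) * S j) + q * S n + 0 ^ n = M ^ n * q ^ M + S n"
    by (simp add: distrib_left)
  moreover obtain r where r: "q = Suc r" "r > 0"
    using assms by (cases q) auto
  ultimately have "M ^ n * q ^ M - 0 ^ n - q * (\<Sum>j<n. (n choose j) * S j) = r * S n"
    by simp
  then show ?thesis
    unfolding S_def[symmetric] using r by simp
qed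

lemma ame_power_sum:
  assumes "ame M" "ame q" "\<And>e. q e \<ge> 2"
  shows "ame (\<lambda>e. \<Sum>a<M e. a ^ n * q e ^ a)"
proof (induction n rule: less_induct)
  case (less n)
  show ?case
    by (rule ame_cong[OF _ power_sum_recurrence]) (intro ame_intros assms less | simp)+
qed

text \<open>The first argument of an exponential polynomial stands for the parameters, the second one for
  the variables \<open>a 0, \<dots>, a (k - 1)\<close> over which one sums.\<close>

inductive exp_poly :: "nat \<Rightarrow> ((nat \<Rightarrow> nat) \<Rightarrow> (nat \<Rightarrow> nat) \<Rightarrow> nat) \<Rightarrow> bool" for k where
  monomial: "ame c \<Longrightarrow> (\<And>i. ame (d i)) \<Longrightarrow>
     exp_poly k (\<lambda>e a. c e * (\<Prod>i<k. a i ^ n i * 2 ^ (d i e * a i)))"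
| add: "exp_poly k F \<Longrightarrow> exp_poly k G \<Longrightarrow> exp_poly k (\<lambda>e a. F e a + G e a)"

lemma exp_poly_const:
  assumes "ame c"
  shows "exp_poly k (\<lambda>e a. c e)"
  using exp_poly.monomial[of c "\<lambda>_ _. 0" k "\<lambda>_. 0"] assms by (simp add: ame.const)

lemma exp_poly_var:
  assumes "i < k"
  shows "exp_poly k (\<lambda>e a. a i)"
proof -
  have "(\<Prod>j<k. a j ^ (if j = i then 1 else 0) * 2 ^ (0 * a j)) = a i" for a :: "nat \<Rightarrow> nat"
    using assms by (simp add: if_distrib[of "power _"] prod.delta del: One_nat_def cong: if_cong)
  then show ?thesis
    using exp_poly.monomial[of "\<lambda>_. 1" "\<lambda>_ _. 0" k "\<lambda>j. if j = i then 1 else 0"]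
    by (simp add: ame.const)
qed

lemma exp_poly_exp:
  assumes "ame d" "i < k"
  shows "exp_poly k (\<lambda>e a. 2 ^ (d e * a i))"
proof -
  have "(\<Prod>j<k. a j ^ 0 * 2 ^ ((if j = i then d e else 0) * a j)) = (2::nat) ^ (d e * a i)" for a e
    using assms(2)
    by (simp add: if_distrib[of "power _"] if_distrib[of "\<lambda>x. x * _"] prod.delta del: One_nat_def cong: if_cong)
  moreover have "ame (\<lambda>e. if j = i then d e else 0)" for j
    by (cases "j = i") (auto intro: assms ame.const)
  ultimately show ?thesis
    using exp_poly.monomial[of "\<lambda>_. 1" "\<lambda>j e. if j = i then d e else 0" k "\<lambda>_. 0"]
    by (simp add: ame.const)
qed

lemma exp_poly_mult:
  assumes "exp_poly k F" "exp_poly k G"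
  shows "exp_poly k (\<lambda>e a. F e a * G e a)"
  using assms(1)
proof induction
  case (monomial c d n)
  show ?case
    using assms(2)
  proof induction
    case (monomial c' d' n')
    have "exp_poly k (\<lambda>e a. (c e * c' e) * (\<Prod>i<k. a i ^ (n i + n' i) * 2 ^ ((d i e + d' i e) * a i)))"
      using \<open>ame c\<close> \<open>\<And>i. ame (d i)\<close> monomial
      by (intro exp_poly.monomial[where d = "\<lambda>i e. d i e + d' i e"] ame_intros)
    moreover have "(c e * c' e) * (\<Prod>i<k. a i ^ (n i + n' i) * 2 ^ ((d i e + d' i e) * a i)) =
      (c e * (\<Prod>i<k. a i ^ n i * 2 ^ (d i e * a i))) * (c' e * (\<Prod>i<k. a i ^ n' i * 2 ^ (d' i e * a i)))"
      for e a :: "nat \<Rightarrow> nat"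
      by (simp only: power_add distrib_right distrib_left prod.distrib mult_ac)
    ultimately show ?case
      by (simp only:)
  next
    case (add F G)
    then show ?case
      by (simp only: distrib_left) (rule exp_poly.add)
  qed
next
  case (add F G)
  then show ?case
    by (simp only: distrib_right) (rule exp_poly.add)
qed

lemmas exp_poly_intros = exp_poly_const exp_poly_var exp_poly_exp exp_poly.add exp_poly_mult

abbreviation box :: "nat \<Rightarrow> (nat \<Rightarrow> (nat \<Rightarrow> nat) \<Rightarrow> nat) \<Rightarrow> (nat \<Rightarrow> nat) \<Rightarrow> (nat \<Rightarrow> nat) set" where
  "box k M e \<equiv> PiE {..<k} (\<lambda>i. {..<M i e})"

lemma finite_box: "finite (box k M e)"
  by (intro finite_PiE) auto

text \<open>All coefficients are nonnegative, so replacing each \<open>a i\<close> by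
  \<open>M i e\<close> bounds a monomial. The bound determines how wide the blocks must be when
  values are packed.\<close>

lemma exp_poly_bounded:
  assumes "exp_poly k F" "\<And>i. i < k \<Longrightarrow> ame (M i)"
  shows "\<exists>h. ame h \<and> (\<forall>e. \<forall>a\<in>box k M e. F e a \<le> h e)"
  using assms(1)
proof induction
  case (monomial c d n)
  have "c e * (\<Prod>i<k. a i ^ n i * 2 ^ (d i e * a i)) \<le> c e * (\<Prod>i<k. M i e ^ n i * 2 ^ (d i e * M i e))"
    if "a \<in> box k M e" for e a
  proof (intro mult_left_mono prod_mono conjI mult_mono power_mono power_increasing)
    fix i assume "i \<in> {..<k}"
    then show "a i \<le> M i e" "a i \<le> M i e"
      using that by (auto dest!: PiE_mem intro: less_imp_le)
  qed auto
  moreover have "ame (\<lambda>e. c e * (\<Prod>i<k. M i e ^ n i * 2 ^ (d i e * M i e)))"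
    using monomial by (intro ame_intros assms(2)) auto
  ultimately show ?case
    by blast
next
  case (add F G)
  then obtain h h' where "ame h" "ame h'" and
    h: "\<forall>e. \<forall>a\<in>box k M e. F e a \<le> h e" "\<forall>e. \<forall>a\<in>box k M e. G e a \<le> h' e"
    by blast
  then have "ame (\<lambda>e. h e + h' e)" "\<forall>e. \<forall>a\<in>box k M e. F e a + G e a \<le> h e + h' e"
    by (auto intro: ame.add add_mono)
  then show ?case
    by blast
qed

text \<open>For a monomial the sum over the box factors into one-dimensional sums of
  \<open>x ^ n i * (2 ^ d i e * q i e) ^ x\<close>, which \<open>ame_power_sum\<close> covers
  because the base is at least 2.\<close>

lemma ame_sum_exp_poly:
  assumes "exp_poly k F" "\<And>i. i < k \<Longrightarrow> ame (M i)" "\<And>i. ame (q i)" "\<And>i e. q i e \<ge> 2"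
  shows "ame (\<lambda>e. \<Sum>a\<in>box k M e. F e a * (\<Prod>i<k. q i e ^ a i))"
  using assms(1)
proof induction
  case (monomial c d n)
  have "(\<Sum>a\<in>box k M e. c e * (\<Prod>i<k. a i ^ n i * 2 ^ (d i e * a i)) * (\<Prod>i<k. q i e ^ a i)) =
    c e * (\<Prod>i<k. \<Sum>x<M i e. x ^ n i * (2 ^ d i e * q i e) ^ x)" for e
  proof -
    have "(\<Prod>i<k. \<Sum>x<M i e. x ^ n i * (2 ^ d i e * q i e) ^ x) =
      (\<Sum>a\<in>box k M e. \<Prod>i<k. a i ^ n i * (2 ^ d i e * q i e) ^ a i)"
      by (rule prod_sum_PiE) auto
    also have "\<dots> = (\<Sum>a\<in>box k M e. (\<Prod>i<k. a i ^ n i * 2 ^ (d i e * a i)) * (\<Prod>i<k. q i e ^ a i))"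
      by (simp add: prod.distrib power_mult_distrib power_mult mult.assoc)
    finally show ?thesis
      by (simp add: sum_distrib_left mult.assoc)
  qed
  moreover have "2 ^ d i e * q i e \<ge> 2" for i e
    using mult_le_mono[of 1 "2 ^ d i e" 2 "q i e"] assms(4) by simp
  then have "ame (\<lambda>e. c e * (\<Prod>i<k. \<Sum>x<M i e. x ^ n i * (2 ^ d i e * q i e) ^ x))"
    by (intro ame_intros ame_power_sum assms monomial) auto
  ultimately show ?case
    by (simp only:)
next
  case (add F G)
  then show ?case
    by (simp only: distrib_right sum.distrib) (rule ame.add)
qed

lemma inj_on_mixed_radix:
  assumes "\<And>i. i < k \<Longrightarrow> M i e \<le> N"
  shows "inj_on (\<lambda>a. \<Sum>i<k. a i * N ^ i) (box k M e)"
proof (rule inj_onI)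
  fix a b assume ab: "a \<in> box k M e" "b \<in> box k M e" "(\<Sum>i<k. a i * N ^ i) = (\<Sum>i<k. b i * N ^ i)"
  have "a i < N" "b i < N" if "i < k" for i
    using that ab assms[OF that] by (auto dest!: PiE_mem[of _ _ _ i])
  then have "a i = b i" if "i < k" for i
    using digit_sum_nth[of k a N i] digit_sum_nth[of k b N i] that ab(3) by metis
  then show "a = b"
    using ab by (intro PiE_ext[of a "{..<k}" "\<lambda>i. {..<M i e}" b]) auto
qed

text \<open>The differences \<open>A a - B a\<close> are packed into blocks of \<open>2 * w\<close>
  bits; \<open>B a <= A a\<close> means that no borrow occurs. Multiplication by
  \<open>2 ^ w - 1\<close> keeps each block within its width and gives it weight \<open>w\<close> or
  0 according to whether the difference is nonzero, so the weight divided by \<open>w\<close> counts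
  the points where \<open>A\<close> and \<open>B\<close> differ.\<close>

lemma card_eq_hamming_weight:
  fixes A B :: "'a \<Rightarrow> nat"
  assumes "finite S" "inj_on t S" "\<And>a. a \<in> S \<Longrightarrow> B a \<le> A a" "\<And>a. a \<in> S \<Longrightarrow> A a \<le> 2 ^ w" "w > 0"
  shows "card {a \<in> S. A a = B a} = card S -
    hamming_weight ((2 ^ w - 1) * ((\<Sum>a\<in>S. A a * 2 ^ (2 * w * t a)) - (\<Sum>a\<in>S. B a * 2 ^ (2 * w * t a)))) div w"
proof -
  have "(\<Sum>a\<in>S. A a * 2 ^ (2 * w * t a)) - (\<Sum>a\<in>S. B a * 2 ^ (2 * w * t a)) =
    (\<Sum>a\<in>S. (A a - B a) * 2 ^ (2 * w * t a))"
    by (subst sum_subtractf_nat[symmetric]) (auto simp: assms diff_mult_distrib)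
  then have "(2 ^ w - 1) * ((\<Sum>a\<in>S. A a * 2 ^ (2 * w * t a)) - (\<Sum>a\<in>S. B a * 2 ^ (2 * w * t a))) =
    (\<Sum>a\<in>S. ((2 ^ w - 1) * (A a - B a)) * 2 ^ (2 * w * t a))"
    by (simp only: sum_distrib_left mult.assoc)
  also have "hamming_weight \<dots> = (\<Sum>a\<in>S. hamming_weight ((2 ^ w - 1) * (A a - B a)))"
  proof (rule hamming_weight_sum_inj)
    fix a assume "a \<in> S"
    then have "A a \<le> 2 ^ w"
      by (rule assms)
    then have "(2 ^ w - 1) * (A a - B a) \<le> (2 ^ w - 1) * 2 ^ w"
      by (intro mult_left_mono) auto
    also have "\<dots> < 2 ^ w * 2 ^ w"
      by (intro mult_strict_right_mono) auto
    finally show "(2 ^ w - 1) * (A a - B a) < 2 ^ (2 * w)"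
      by (simp only: mult_2 power_add)
  qed (use assms in auto)
  also have "\<dots> = (\<Sum>a\<in>S. if A a = B a then 0 else w)"
  proof (intro sum.cong refl)
    fix a assume "a \<in> S"
    then show "hamming_weight ((2 ^ w - 1) * (A a - B a)) = (if A a = B a then 0 else w)"
      using assms(3,4)[of a] by (subst hamming_weight_mult_mersenne) auto
  qed
  also have "\<dots> = card {a \<in> S. A a \<noteq> B a} * w"
    using assms(1) by (simp add: sum.If_cases Int_def)
  finally have "hamming_weight ((2 ^ w - 1) * ((\<Sum>a\<in>S. A a * 2 ^ (2 * w * t a)) - (\<Sum>a\<in>S. B a * 2 ^ (2 * w * t a)))) div w
     = card {a \<in> S. A a \<noteq> B a}"
    using assms(5) by simp
  moreover have "card S = card {a \<in> S. A a = B a} + card {a \<in> S. A a \<noteq> B a}"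
    using assms(1) by (subst card_Un_disjoint[symmetric]) (auto intro: arg_cong[where f = card])
  ultimately show ?thesis
    by simp
qed

lemma ame_card_exp_poly_eq:
  assumes "exp_poly k A" "exp_poly k B" "\<And>e a. B e a \<le> A e a" "\<And>i. i < k \<Longrightarrow> ame (M i)"
  shows "ame (\<lambda>e. card {a \<in> box k M e. A e a = B e a})"
proof -
  obtain h where h: "ame h" "\<And>e a. a \<in> box k M e \<Longrightarrow> A e a \<le> h e"
    using exp_poly_bounded[OF assms(1), of M] assms(4) by blast
  \<comment> \<open>The increment makes the block width positive, since it will be a
    divisor.\<close>
  define w where "w e = h e + 1" for e
  \<comment> \<open>A positive number that bounds all sides of the box, so that \<open>a\<close> is
    determined by the number with base-\<open>N e\<close> digits \<open>a i\<close>.\<close>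
  define N where "N e = (\<Sum>i<k. M i e) + 1" for e
  \<comment> \<open>With these bases the factor that moves the block of \<open>a\<close> to its
    position splits as the product of \<open>q i e ^ a i\<close>, the form that
    \<open>ame_sum_exp_poly\<close> requires.\<close>
  define q :: "nat \<Rightarrow> (nat \<Rightarrow> nat) \<Rightarrow> nat" where "q i e = 2 ^ (2 * w e * N e ^ i)" for i e
  have ame: "ame w" "ame (q i)" for i
    unfolding w_def N_def q_def by (intro ame_intros h assms; simp)+
  have bound: "A e a \<le> 2 ^ w e" if "a \<in> box k M e" for e a
  proof -
    have "A e a \<le> w e"
      using h(2)[OF that] by (simp add: w_def)
    also have "\<dots> \<le> 2 ^ w e"
      by (intro less_imp_le less_exp)
    finally show ?thesis .
  qed
  have q: "q i e \<ge> 2" for i e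
    unfolding q_def by (rule order_trans[OF _ power_increasing[of 1]]) (auto simp: w_def N_def Suc_le_eq)
  have inj: "inj_on (\<lambda>a. \<Sum>i<k. a i * N e ^ i) (box k M e)" for e
  proof (rule inj_on_mixed_radix)
    fix i assume "i < k"
    then have "M i e \<le> (\<Sum>i<k. M i e)"
      by (intro member_le_sum) auto
    then show "M i e \<le> N e"
      by (simp add: N_def)
  qed
  have weight: "2 ^ (2 * w e * (\<Sum>i<k. a i * N e ^ i)) = (\<Prod>i<k. q i e ^ a i)" for e a
    by (simp add: q_def power_sum power_mult[symmetric] sum_distrib_left mult_ac)
  have card: "card (box k M e) = (\<Prod>i<k. M i e)" for e
    by (simp add: card_PiE)
  have "card {a \<in> box k M e. A e a = B e a} = (\<Prod>i<k. M i e) - hamming_weight ((2 ^ w e - 1) *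
    ((\<Sum>a\<in>box k M e. A e a * (\<Prod>i<k. q i e ^ a i)) - (\<Sum>a\<in>box k M e. B e a * (\<Prod>i<k. q i e ^ a i)))) div w e" for e
    unfolding card[symmetric] weight[symmetric]
  proof (rule card_eq_hamming_weight)
    show "w e > 0"
      by (simp add: w_def)
  qed (fact finite_box inj | erule bound | rule assms(3))+
  moreover have "ame (\<lambda>e. (\<Prod>i<k. M i e) - hamming_weight ((2 ^ w e - 1) *
    ((\<Sum>a\<in>box k M e. A e a * (\<Prod>i<k. q i e ^ a i)) - (\<Sum>a\<in>box k M e. B e a * (\<Prod>i<k. q i e ^ a i)))) div w e)"
    by (intro ame_intros ame_sum_exp_poly ame assms q) simp
  ultimately show ?thesis
    by (simp only:)
qed

text \<open>The condition \<open>B e a <= A e a\<close> stands in for a single nonnegative function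
  \<open>A - B\<close>: exponential polynomials have no negative coefficients, yet conjunction and
  disjunction need such a difference.\<close>

definition exp_eq :: "nat \<Rightarrow> ((nat \<Rightarrow> nat) \<Rightarrow> (nat \<Rightarrow> nat) \<Rightarrow> bool) \<Rightarrow> bool" where
  "exp_eq k R \<longleftrightarrow> (\<exists>A B. exp_poly k A \<and> exp_poly k B \<and> (\<forall>e a. B e a \<le> A e a) \<and>
     (\<forall>e a. R e a \<longleftrightarrow> A e a = B e a))"

lemma ame_card_exp_eq:
  assumes "exp_eq k R" "\<And>i. i < k \<Longrightarrow> ame (M i)"
  shows "ame (\<lambda>e. card {a \<in> box k M e. R e a})"
proof -
  from assms(1) obtain A B where "exp_poly k A" "exp_poly k B" "\<forall>e a. B e a \<le> A e a"
    and R: "\<forall>e a. R e a \<longleftrightarrow> A e a = B e a"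
    unfolding exp_eq_def by blast
  then have "ame (\<lambda>e. card {a \<in> box k M e. A e a = B e a})"
    using assms(2) by (intro ame_card_exp_poly_eq) auto
  then show ?thesis
    using R by simp
qed

text \<open>An arbitrary equation becomes one with ordered sides because the square of
  \<open>F - G\<close> is nonnegative and vanishes exactly when \<open>F = G\<close>.\<close>

lemma exp_eqI:
  assumes "exp_poly k F" "exp_poly k G"
  shows "exp_eq k (\<lambda>e a. F e a = G e a)"
proof -
  have *: "2 * x * y \<le> x * x + y * y \<and> (x = y \<longleftrightarrow> x * x + y * y = 2 * x * y)" for x y :: nat
  proof -
    have "2 * a * b \<le> a * a + b * b \<and> (a = b \<longleftrightarrow> a * a + b * b = 2 * a * b)" if ab: "a \<le> b" for a b :: nat
    proof -
      obtain c where "b = a + c"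
        using ab le_Suc_ex by blast
      then show ?thesis
        by (simp add: distrib_left distrib_right)
    qed
    from this[of x y] this[of y x] show ?thesis
      by (cases "x \<le> y") (simp_all add: ac_simps eq_commute)
  qed
  show ?thesis
    unfolding exp_eq_def
  proof (intro exI conjI allI)
    show "exp_poly k (\<lambda>e a. F e a * F e a + G e a * G e a)" "exp_poly k (\<lambda>e a. 2 * F e a * G e a)"
      by (intro exp_poly_intros assms ame.const)+
    show "2 * F e a * G e a \<le> F e a * F e a + G e a * G e a" for e a
      by (rule *[THEN conjunct1])
    show "F e a = G e a \<longleftrightarrow> F e a * F e a + G e a * G e a = 2 * F e a * G e a" for e a
      by (rule *[THEN conjunct2])
  qed
qed

text \<open>A sum of nonnegative differences vanishes only if both do.\<close>

lemma exp_eq_conj: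
  assumes "exp_eq k R" "exp_eq k Q"
  shows "exp_eq k (\<lambda>e a. R e a \<and> Q e a)"
proof -
  obtain A B where AB: "exp_poly k A" "exp_poly k B" "\<forall>e a. B e a \<le> A e a" "\<forall>e a. R e a \<longleftrightarrow> A e a = B e a"
    using assms(1) unfolding exp_eq_def by blast
  obtain C D where CD: "exp_poly k C" "exp_poly k D" "\<forall>e a. D e a \<le> C e a" "\<forall>e a. Q e a \<longleftrightarrow> C e a = D e a"
    using assms(2) unfolding exp_eq_def by blast
  have *: "x + x' = y + y' \<longleftrightarrow> x = y \<and> x' = y'" if "y \<le> x" "y' \<le> x'" for x x' y y' :: nat
    using that by linarith
  show ?thesis
    unfolding exp_eq_def
  proof (intro exI conjI allI)
    show "exp_poly k (\<lambda>e a. A e a + C e a)" "exp_poly k (\<lambda>e a. B e a + D e a)"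
      by (intro exp_poly_intros AB CD)+
    show "B e a + D e a \<le> A e a + C e a" for e a
      using AB(3) CD(3) by (simp add: add_mono)
    show "(R e a \<and> Q e a) \<longleftrightarrow> A e a + C e a = B e a + D e a" for e a
      using AB(3,4) CD(3,4) *[of "B e a" "A e a" "D e a" "C e a"] by simp
  qed
qed

text \<open>The product \<open>(A - B) * (C - D)\<close> of the two differences is expanded and its
  negative terms are moved to the other side.\<close>

lemma exp_eq_disj:
  assumes "exp_eq k R" "exp_eq k Q"
  shows "exp_eq k (\<lambda>e a. R e a \<or> Q e a)"
proof -
  obtain A B where AB: "exp_poly k A" "exp_poly k B" "\<forall>e a. B e a \<le> A e a" "\<forall>e a. R e a \<longleftrightarrow> A e a = B e a"
    using assms(1) unfolding exp_eq_def by blast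
  obtain C D where CD: "exp_poly k C" "exp_poly k D" "\<forall>e a. D e a \<le> C e a" "\<forall>e a. Q e a \<longleftrightarrow> C e a = D e a"
    using assms(2) unfolding exp_eq_def by blast
  have *: "x * y' + y * x' \<le> x * x' + y * y' \<and> (x = y \<or> x' = y' \<longleftrightarrow> x * x' + y * y' = x * y' + y * x')"
    if le: "y \<le> x" "y' \<le> x'" for x x' y y' :: nat
  proof -
    obtain s s' where "x = y + s" "x' = y' + s'"
      using le le_Suc_ex by blast
    then show ?thesis
      by (simp add: distrib_left distrib_right)
  qed
  show ?thesis
    unfolding exp_eq_def
  proof (intro exI conjI allI)
    show "exp_poly k (\<lambda>e a. A e a * C e a + B e a * D e a)"
      "exp_poly k (\<lambda>e a. A e a * D e a + B e a * C e a)"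
      by (intro exp_poly_intros AB CD)+
    show "A e a * D e a + B e a * C e a \<le> A e a * C e a + B e a * D e a" for e a
      using AB(3) CD(3) *[of "B e a" "A e a" "D e a" "C e a"] by simp
    show "(R e a \<or> Q e a) \<longleftrightarrow> A e a * C e a + B e a * D e a = A e a * D e a + B e a * C e a" for e a
      using AB(3,4) CD(3,4) *[of "B e a" "A e a" "D e a" "C e a"] by simp
  qed
qed

lemmas exp_eq_intros = exp_eqI exp_eq_conj exp_eq_disj

section \<open>Bounded sums and products\<close>

text \<open>Splitting \<open>X\<close> at position \<open>z\<close> in base \<open>Q\<close> into a
  lower part \<open>d\<close>, a digit and an upper part \<open>c\<close> is unique once
  \<open>d < Q ^ z\<close>. The slack \<open>d'\<close> turns this inequality into an equation and
  is itself determined. The digit in turn splits uniquely in base \<open>N\<close>.\<close>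

lemma packed_decode:
  fixes X N Q z u v a b c d d' :: nat
  assumes "Q = N * N" "X div Q ^ z mod Q = u + N * v" "u < N" "v < N" "a < N" "b < N"
  shows "X = d + (a + N * b) * Q ^ z + c * Q * Q ^ z \<and> d + d' + 1 = Q ^ z \<longleftrightarrow>
    a = u \<and> b = v \<and> c = X div Q ^ z div Q \<and> d = X mod Q ^ z \<and> d' = Q ^ z - 1 - X mod Q ^ z"
    (is "?L \<longleftrightarrow> ?R")
proof
  have "Q > 0"
    using assms by auto
  assume ?L
  then have X: "X = d + (a + N * b + c * Q) * Q ^ z" and d: "d < Q ^ z"
    by (simp_all add: distrib_right)
  have less: "a + N * b < Q"
  proof -
    have "N * (b + 1) \<le> N * N"
      using assms by (intro mult_left_mono) auto
    then show ?thesis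
      using assms by simp
  qed
  have mod: "X mod Q ^ z = d" and div: "X div Q ^ z = a + N * b + c * Q"
    using d \<open>Q > 0\<close> unfolding X by simp_all
  have "a + N * b = u + N * v" and c: "X div Q ^ z div Q = c"
    using less assms(2) \<open>Q > 0\<close> unfolding div by simp_all
  then have "(a + N * b) mod N = (u + N * v) mod N" "(a + N * b) div N = (u + N * v) div N"
    by simp_all
  then have "a = u" "b = v"
    using assms by simp_all
  then show ?R
    using mod c d \<open>?L\<close> by auto
next
  assume R: ?R
  have "Q ^ z > 0"
    using assms by auto
  have "X = X mod Q ^ z + X div Q ^ z * Q ^ z"
    by (simp only: mod_div_mult_eq)
  also have "X div Q ^ z = u + N * v + X div Q ^ z div Q * Q"
    unfolding assms(2)[symmetric] by simp
  finally have "X = d + (a + N * b) * Q ^ z + c * Q * Q ^ z"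
    using R by (simp only: distrib_right add.assoc)
  moreover have "X mod Q ^ z < Q ^ z"
    using \<open>Q ^ z > 0\<close> by (rule mod_less_divisor)
  ultimately show ?L
    using R by linarith
qed

lemma all_less_11: "(\<forall>i<11. P i) \<longleftrightarrow> P 0 \<and> P 1 \<and> P 2 \<and> P 3 \<and> P 4 \<and> P 5 \<and> P 6 \<and> P 7 \<and> P 8 \<and> P 9 \<and> P (10::nat)"
  by (simp add: numeral_eq_Suc All_less_Suc) blast

text \<open>The digits \<open>u\<close> and \<open>v\<close> of the packed sums are recovered by guessing; the witnesses are unique, so
  that counting solutions computes a sum over \<open>z\<close>. The variables are
  \<open>a 0 = z\<close>, \<open>a 1 = u\<close>, \<open>a 2 = v\<close>, the remaining digits \<open>a 3\<close> above and \<open>a 4\<close> below position \<open>z\<close>,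
  the witnesses \<open>a 6\<close>, \<open>a 7\<close>, \<open>a 8\<close> for \<open>P\<close>, an index \<open>a 9\<close> below the summand,
  and the slack variables \<open>a 5\<close> and \<open>a 10\<close>.\<close>

lemma ame_packed_sum_map:
  fixes u v :: "nat \<Rightarrow> (nat \<Rightarrow> nat) \<Rightarrow> nat"
  assumes y: "ame y" and w: "ame w" and w': "ame w'" and S: "ame S"
    and U: "ame (\<lambda>e. \<Sum>z<y e. u z e * 2 ^ (2 * w e * z))"
    and V: "ame (\<lambda>e. \<Sum>z<y e. v z e * 2 ^ (2 * w e * z))"
    and less: "\<And>e z. z < y e \<Longrightarrow> u z e < 2 ^ w e" "\<And>e z. z < y e \<Longrightarrow> v z e < 2 ^ w e"
    and P: "exp_eq 11 P" and C: "exp_poly 11 C"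
    and P_iff: "\<And>e a. a 1 < 2 ^ w e \<Longrightarrow> a 2 < 2 ^ w e \<Longrightarrow>
      a 6 < 2 ^ w e \<and> a 7 < 2 ^ w e \<and> a 8 < 2 ^ w e \<and> P e a \<longleftrightarrow>
      a 6 = q (a 1) (a 2) \<and> a 7 = r (a 1) (a 2) \<and> a 8 = r' (a 1) (a 2)"
    and C_eq: "\<And>e a. a 7 = r (a 1) (a 2) \<Longrightarrow> C e a = h (a 1) (a 2)"
    and h_le: "\<And>e m n. m < 2 ^ w e \<Longrightarrow> n < 2 ^ w e \<Longrightarrow> h m n \<le> S e"
  shows "ame (\<lambda>e. \<Sum>z<y e. h (u z e) (v z e) * 2 ^ (w' e * z))"
proof -
  define N :: "(nat \<Rightarrow> nat) \<Rightarrow> nat" where "N e = 2 ^ w e" for e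
  \<comment> \<open>Both packed numbers are merged into one whose digit in base
    \<open>N e * N e\<close> at position \<open>z\<close> is
    \<open>u z e + N e * v z e\<close>.\<close>
  define X where "X e = (\<Sum>z<y e. u z e * 2 ^ (2 * w e * z)) + N e * (\<Sum>z<y e. v z e * 2 ^ (2 * w e * z))" for e
  \<comment> \<open>The last equation, with slack \<open>a 10\<close>, lets \<open>a 9\<close> take
    exactly \<open>C e a * 2 ^ (w' e * a 0)\<close> values, so that counting produces the weighted
    summand.\<close>
  define R where "R e a \<longleftrightarrow>
    (X e = a 4 + (a 1 + N e * a 2) * 2 ^ (2 * w e * a 0) + a 3 * 2 ^ (2 * w e) * 2 ^ (2 * w e * a 0) \<and>
     a 4 + a 5 + 1 = 2 ^ (2 * w e * a 0)) \<and> P e a \<and> a 9 + a 10 + 1 = C e a * 2 ^ (w' e * a 0)" for e a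
  \<comment> \<open>The bounds \<open>y\<close> and \<open>N\<close> restrict the position, the
    digits and the witnesses for \<open>P\<close>; the others merely leave room for the intended
    values, where \<open>S\<close> enters through \<open>h_le\<close>.\<close>
  define Ms where "Ms = [y, N, N, \<lambda>e. X e + 1, \<lambda>e. 2 ^ (2 * w e * y e), \<lambda>e. 2 ^ (2 * w e * y e),
    N, N, N, \<lambda>e. S e * 2 ^ (w' e * y e), \<lambda>e. S e * 2 ^ (w' e * y e)]"
  have X: "ame X" and N: "ame N"
    unfolding X_def N_def by (intro ame_intros U V w)+
  then have "ame (\<lambda>e. Suc (X e))"
    using ame.add[OF X ame.const[of 1]] by simp
  have "\<forall>i<11. ame (Ms ! i)"
    unfolding all_less_11 by (simp add: Ms_def) (intro conjI ame_intros y w w' S N \<open>ame (\<lambda>e. Suc (X e))\<close>)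
  then have "ame (\<lambda>e. card {a \<in> box 11 (\<lambda>i. Ms ! i) e. R e a})"
    unfolding R_def
    by (intro ame_card_exp_eq exp_eq_intros exp_poly_intros P C ame_intros w w' X N; simp)
  moreover have "card {a \<in> box 11 (\<lambda>i. Ms ! i) e. R e a} = (\<Sum>z<y e. h (u z e) (v z e) * 2 ^ (w' e * z))" for e
  proof -
    define Q :: nat where "Q = 2 ^ (2 * w e)"
    have QN: "Q = N e * N e"
      by (simp add: Q_def N_def mult_2 power_add)
    have pow_Q: "2 ^ (2 * w e * x) = Q ^ x" for x
      by (simp add: Q_def power_mult)
    have "Q \<ge> 1" "N e \<ge> 1"
      by (auto simp: Q_def N_def)
    define dig where "dig z = u z e + N e * v z e" for z
    have X_sum: "X e = (\<Sum>z<y e. dig z * Q ^ z)"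
      unfolding X_def dig_def pow_Q by (simp add: sum_distrib_left sum.distrib distrib_right mult.assoc)
    have uv: "u z e < N e" "v z e < N e" if "z < y e" for z
      using less that by (auto simp: N_def)
    have "dig z < Q" if "z < y e" for z
    proof -
      have "N e * (v z e + 1) \<le> N e * N e"
        using uv[OF that] by (intro mult_left_mono) auto
      then show ?thesis
        using uv[OF that] by (simp add: dig_def QN)
    qed
    then have digit: "X e div Q ^ z mod Q = dig z" if "z < y e" for z
      unfolding X_sum using that by (intro digit_sum_nth) auto
    define H where "H z = h (u z e) (v z e) * 2 ^ (w' e * z)" for z
    \<comment> \<open>The only admissible values of the eleven variables once \<open>a 0 = z\<close>
      and \<open>a 9 = s\<close> are fixed.\<close>
    define g where "g z s = [z, u z e, v z e, X e div Q ^ z div Q, X e mod Q ^ z, Q ^ z - 1 - X e mod Q ^ z,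
      q (u z e) (v z e), r (u z e) (v z e), r' (u z e) (v z e), s, H z - 1 - s]" for z s
    have R_iff: "(\<forall>i<11. a i < (Ms ! i) e) \<and> R e a \<longleftrightarrow>
        a 0 < y e \<and> a 9 < H (a 0) \<and> (\<forall>i<11. a i = g (a 0) (a 9) ! i)" (is "?L \<longleftrightarrow> ?R") for a
    proof
      assume L: ?L
      then have z: "a 0 < y e" and a: "a 1 < N e" "a 2 < N e" "a 6 < N e" "a 7 < N e" "a 8 < N e"
        by (auto simp: all_less_11 Ms_def)
      have dec: "a 1 = u (a 0) e \<and> a 2 = v (a 0) e \<and> a 3 = X e div Q ^ a 0 div Q \<and>
          a 4 = X e mod Q ^ a 0 \<and> a 5 = Q ^ a 0 - 1 - X e mod Q ^ a 0"
        by (rule packed_decode[OF QN digit[OF z, unfolded dig_def] uv[OF z] a(1,2), THEN iffD1])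
          (use L in \<open>simp add: R_def pow_Q Q_def[symmetric]\<close>)
      have "P e a"
        using L by (simp add: R_def)
      then have "a 6 = q (a 1) (a 2) \<and> a 7 = r (a 1) (a 2) \<and> a 8 = r' (a 1) (a 2)"
        by (intro P_iff[THEN iffD1]) (use a in \<open>simp_all add: N_def\<close>)
      moreover from this have "C e a = h (a 1) (a 2)"
        by (intro C_eq) auto
      moreover have "a 9 + a 10 + 1 = C e a * 2 ^ (w' e * a 0)"
        using L by (simp add: R_def)
      ultimately show ?R
        using z dec by (simp add: all_less_11 g_def H_def)
    next
      assume R: ?R
      then have z: "a 0 < y e" and s: "a 9 < H (a 0)" and a10: "a 10 = H (a 0) - 1 - a 9"
        and dec: "a 1 = u (a 0) e \<and> a 2 = v (a 0) e \<and> a 3 = X e div Q ^ a 0 div Q \<and>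
          a 4 = X e mod Q ^ a 0 \<and> a 5 = Q ^ a 0 - 1 - X e mod Q ^ a 0"
        and qr: "a 6 = q (a 1) (a 2) \<and> a 7 = r (a 1) (a 2) \<and> a 8 = r' (a 1) (a 2)"
        by (simp_all add: all_less_11 g_def)
      have a: "a 1 < N e" "a 2 < N e"
        using dec uv[OF z] by auto
      have P': "a 6 < N e \<and> a 7 < N e \<and> a 8 < N e \<and> P e a"
        unfolding N_def by (rule P_iff[THEN iffD2]) (use a qr in \<open>simp_all add: N_def\<close>)
      have dec': "X e = a 4 + (a 1 + N e * a 2) * Q ^ a 0 + a 3 * Q * Q ^ a 0 \<and> a 4 + a 5 + 1 = Q ^ a 0"
        by (rule packed_decode[OF QN digit[OF z, unfolded dig_def] uv[OF z] a, THEN iffD2]) (rule dec)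
      have "C e a = h (a 1) (a 2)"
        using qr by (intro C_eq) auto
      then have C': "a 9 + a 10 + 1 = C e a * 2 ^ (w' e * a 0)"
        using s dec by (simp add: a10 H_def)
      have "H (a 0) \<le> S e * 2 ^ (w' e * y e)"
        unfolding H_def using z uv[OF z] by (intro mult_mono power_increasing h_le) (auto simp: N_def)
      then have "a 9 < S e * 2 ^ (w' e * y e)" "a 10 < S e * 2 ^ (w' e * y e)"
        using s a10 by simp_all
      moreover have "Q ^ a 0 \<le> Q ^ y e"
        using z \<open>Q \<ge> 1\<close> by (intro power_increasing) auto
      then have "a 4 < Q ^ y e" "a 5 < Q ^ y e"
        using dec' by linarith+
      moreover have "a 3 < X e + 1"
        using dec by (simp add: less_Suc_eq_le) (meson div_le_dividend order_trans)
      ultimately show ?L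
        using z a P' dec' C' by (simp add: all_less_11 Ms_def R_def pow_Q Q_def[symmetric])
    qed
    \<comment> \<open>Solutions correspond to pairs \<open>(z, s)\<close> with
      \<open>s < H z\<close>, whose number is the sum of \<open>H z\<close> over
      \<open>z < y e\<close>.\<close>
    have "bij_betw (\<lambda>a. (a 0, a 9)) {a \<in> box 11 (\<lambda>i. Ms ! i) e. R e a} (SIGMA z:{..<y e}. {..<H z})"
    proof (rule bij_betw_byWitness)
      let ?g = "\<lambda>(z, s). restrict (\<lambda>i. g z s ! i) {..<11}"
      have box_iff: "a \<in> box 11 (\<lambda>i. Ms ! i) e \<longleftrightarrow> (\<forall>i<11. a i < (Ms ! i) e) \<and> a \<in> extensional {..<11}" for a
        by (auto simp: PiE_def Pi_def)
      show "\<forall>a\<in>{a \<in> box 11 (\<lambda>i. Ms ! i) e. R e a}. ?g (a 0, a 9) = a"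
      proof
        fix a assume "a \<in> {a \<in> box 11 (\<lambda>i. Ms ! i) e. R e a}"
        then have a: "\<forall>i<11. a i = g (a 0) (a 9) ! i" "a \<in> extensional {..<11}"
          using R_iff[of a] unfolding box_iff by blast+
        show "?g (a 0, a 9) = a"
        proof (rule extensionalityI[OF _ a(2)])
          fix i assume "i \<in> {..<11::nat}"
          then have "?g (a 0, a 9) i = g (a 0) (a 9) ! i" and "i < 11"
            by (simp_all only: case_prod_conv restrict_apply' lessThan_iff)
          then show "?g (a 0, a 9) i = a i"
            by (rule trans[OF _ a(1)[rule_format, symmetric]])
        qed simp
      qed
      show "\<forall>p\<in>(SIGMA z:{..<y e}. {..<H z}). (?g p 0, ?g p 9) = p"
        by (auto simp: g_def)
      show "(\<lambda>a. (a 0, a 9)) ` {a \<in> box 11 (\<lambda>i. Ms ! i) e. R e a} \<subseteq> (SIGMA z:{..<y e}. {..<H z})"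
        using R_iff unfolding box_iff by blast
      show "?g ` (SIGMA z:{..<y e}. {..<H z}) \<subseteq> {a \<in> box 11 (\<lambda>i. Ms ! i) e. R e a}"
      proof (rule image_subsetI)
        fix p assume "p \<in> (SIGMA z:{..<y e}. {..<H z})"
        then obtain z s where p: "p = (z, s)" "z < y e" "s < H z"
          by blast
        have "?g p 0 = z" "?g p 9 = s" "\<forall>i<11. ?g p i = g z s ! i"
          by (simp_all add: p(1) g_def)
        moreover have "?g p \<in> extensional {..<11}"
          by (simp add: p(1))
        ultimately show "?g p \<in> {a \<in> box 11 (\<lambda>i. Ms ! i) e. R e a}"
          using R_iff[of "?g p"] p(2,3) box_iff[of "?g p"] by (simp only: mem_Collect_eq) blast
      qed
    qed
    then have "card {a \<in> box 11 (\<lambda>i. Ms ! i) e. R e a} = card (SIGMA z:{..<y e}. {..<H z})"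
      by (rule bij_betw_same_card)
    then show ?thesis
      by (simp add: H_def)
  qed
  ultimately show ?thesis
    by (simp only:)
qed

text \<open>Sums and powers of two are monotone and a remainder is bounded by its dividend. For a
  variable, \<open>e i + y e\<close> serves both \<open>i = k\<close> and \<open>i\<close> different
  from \<open>k\<close>.\<close>

lemma ame_majorant:
  assumes "ame f" "ame y"
  shows "\<exists>h. ame h \<and> (\<forall>e. \<forall>z<y e. f (e(k := z)) \<le> h e)"
  using assms(1)
proof induction
  case (const c)
  show ?case
    by (intro exI[of _ "\<lambda>_. c"]) (auto intro: ame.const)
next
  case (var i)
  show ?case
    by (intro exI[of _ "\<lambda>e. e i + y e"]) (auto intro!: ame_intros assms(2))
next
  case (add f g)
  then obtain h h' where "ame h" "ame h'" "\<forall>e. \<forall>z<y e. f (e(k := z)) \<le> h e"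
    "\<forall>e. \<forall>z<y e. g (e(k := z)) \<le> h' e"
    by blast
  then show ?case
    by (intro exI[of _ "\<lambda>e. h e + h' e"] conjI ame.add allI impI add_mono) blast+
next
  case (mod f g)
  then obtain h where "ame h" "\<forall>e. \<forall>z<y e. f (e(k := z)) \<le> h e"
    by blast
  then show ?case
    by (intro exI[of _ h] conjI allI impI order_trans[OF mod_less_eq_dividend]) blast+
next
  case (exp2 f)
  then obtain h where "ame h" "\<forall>e. \<forall>z<y e. f (e(k := z)) \<le> h e"
    by blast
  then show ?case
    by (intro exI[of _ "\<lambda>e. 2 ^ h e"] conjI ame.exp2 allI impI power_increasing) (blast | simp)+
qed

lemma ame_if_zero:
  assumes "ame c" "ame f" "ame g"
  shows "ame (\<lambda>e. if c e = 0 then f e else g e)"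
proof -
  have "ame (\<lambda>e. (1 - c e) * f e + (1 - (1 - c e)) * g e)"
    by (intro ame_intros assms)
  then show ?thesis
    by (rule ame_cong) auto
qed

lemma ame_packed_power_sum:
  assumes "ame y" "ame w" and "ame (\<lambda>e. \<Sum>z<y e. z ^ n)"
  shows "ame (\<lambda>e. \<Sum>z<y e. z ^ n * 2 ^ (w e * z))"
proof -
  \<comment> \<open>The exponent is \<open>w e\<close>, corrected to 1 where \<open>w e = 0\<close>:
    \<open>ame_power_sum\<close> demands a base of at least 2 for every \<open>e\<close>, also where
    the other branch is taken.\<close>
  have "2 ^ (w e + (1 - w e)) \<ge> (2 :: nat)" for e
    by (rule order_trans[OF _ power_increasing[of 1]]) auto
  then have "ame (\<lambda>e. if w e = 0 then \<Sum>z<y e. z ^ n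
      else \<Sum>z<y e. z ^ n * (2 ^ (w e + (1 - w e))) ^ z)"
    by (intro ame_if_zero ame_power_sum ame_intros assms)
  then show ?thesis
    by (rule ame_cong) (auto simp: power_mult)
qed

text \<open>The width \<open>w\<close> must be arbitrary in the induction: for remainders and powers
  of two the operands are packed anew with a width \<open>2 * b e\<close> that accommodates their
  majorants, whatever width the result has.\<close>

lemma ame_packed_sum:
  assumes "ame f" "ame y" "ame w"
  shows "ame (\<lambda>e. \<Sum>z<y e. f (e(k := z)) * 2 ^ (w e * z))"
proof -
  have geometric: "ame (\<lambda>e. \<Sum>z<y e. 2 ^ (w e * z))" if "ame w" for w
    using ame_packed_power_sum[OF assms(2) that, of 0] assms(2) by simp
  show ?thesis
    using assms(1,3)
  proof (induction arbitrary: w)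
    case (const c)
    show ?case
      unfolding sum_distrib_left[symmetric] by (intro ame_intros geometric const)
  next
    case (var i)
    show ?case
    proof (cases "i = k")
      case True
      have "(\<Sum>z<n. z ^ 1) = n * (n - 1) div 2" for n :: nat
        using Sum_Ico_nat[of 0 n] by (simp add: lessThan_atLeast0)
      then have "ame (\<lambda>e. \<Sum>z<y e. z ^ 1)"
        by (simp only:) (intro ame_intros assms(2))
      from ame_packed_power_sum[OF assms(2) var this] show ?thesis
        using True by simp
    next
      case False
      have "ame (\<lambda>e. e i * (\<Sum>z<y e. 2 ^ (w e * z)))"
        by (intro ame_intros geometric var)
      then show ?thesis
        using False by (simp add: sum_distrib_left)
    qed
  next
    case (add f g)
    show ?case
      unfolding distrib_right sum.distrib by (intro ame.add add)
  next
    case (mod f g)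
    obtain h1 where h1: "ame h1" "\<And>e z. z < y e \<Longrightarrow> f (e(k := z)) \<le> h1 e"
      using ame_majorant[OF mod.hyps(1) assms(2)] by blast
    obtain h2 where h2: "ame h2" "\<And>e z. z < y e \<Longrightarrow> g (e(k := z)) \<le> h2 e"
      using ame_majorant[OF mod.hyps(2) assms(2)] by blast
    define b where "b e = h1 e + h2 e" for e
    have b: "ame b"
      unfolding b_def by (intro ame_intros h1 h2)
    have less: "f (e(k := z)) < 2 ^ b e" "g (e(k := z)) < 2 ^ b e" if "z < y e" for e z
      using h1(2)[OF that] h2(2)[OF that] less_exp[of "b e"] unfolding b_def by linarith+
    \<comment> \<open>Here \<open>a 6\<close> is the quotient, \<open>a 7\<close> the remainder and
      \<open>a 8\<close> the slack of \<open>a 7 < a 2\<close>. The second alternative is division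
      by zero, where \<open>a 6\<close> and \<open>a 8\<close> are fixed as 0 to keep the witnesses
      unique and \<open>a 7 = a 1\<close>.\<close>
    show ?case
    proof (rule ame_packed_sum_map[where w = b and S = "\<lambda>e. 2 ^ b e" and h = "(mod)"
        and P = "\<lambda>e a. a 1 = a 6 * a 2 + a 7 \<and> (a 7 + a 8 + 1 = a 2 \<or> (a 2 = 0 \<and> a 6 = 0 \<and> a 8 = 0))"
        and C = "\<lambda>e a. a 7" and q = "(div)" and r = "(mod)" and r' = "\<lambda>m n. n - (m mod n) - 1"])
      show "exp_eq 11 (\<lambda>e a. a 1 = a 6 * a 2 + a 7 \<and> (a 7 + a 8 + 1 = a 2 \<or> (a 2 = 0 \<and> a 6 = 0 \<and> a 8 = 0)))"
        by (intro exp_eq_intros exp_poly_intros ame.const) simp_all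
      show "exp_poly 11 (\<lambda>e a. a 7)"
        by (intro exp_poly_var) simp
      fix e and a :: "nat \<Rightarrow> nat"
      assume a: "a 1 < 2 ^ b e" "a 2 < 2 ^ b e"
      show "a 6 < 2 ^ b e \<and> a 7 < 2 ^ b e \<and> a 8 < 2 ^ b e \<and>
        a 1 = a 6 * a 2 + a 7 \<and> (a 7 + a 8 + 1 = a 2 \<or> (a 2 = 0 \<and> a 6 = 0 \<and> a 8 = 0)) \<longleftrightarrow>
        a 6 = a 1 div a 2 \<and> a 7 = a 1 mod a 2 \<and> a 8 = a 2 - a 1 mod a 2 - 1" (is "?L \<longleftrightarrow> ?R")
      proof
        assume L: ?L
        show ?R
        proof (cases "a 2 = 0")
          case False
          then have *: "a 7 < a 2" "a 8 = a 2 - a 7 - 1"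
            using L by auto
          then show ?thesis
            using L False by simp
        qed (use L in auto)
      next
        assume R: ?R
        have "a 6 \<le> a 1" "a 7 \<le> a 1" "a 8 \<le> a 2"
          using R by auto
        then have "a 6 < 2 ^ b e" "a 7 < 2 ^ b e" "a 8 < 2 ^ b e"
          using a by (meson le_less_trans)+
        moreover have "a 1 = a 6 * a 2 + a 7"
          using R by simp
        moreover have "a 7 + a 8 + 1 = a 2 \<or> (a 2 = 0 \<and> a 6 = 0 \<and> a 8 = 0)"
        proof (cases "a 2 = 0")
          case True
          then show ?thesis
            using R by simp
        next
          case False
          then have "a 1 mod a 2 < a 2"
            by simp
          then show ?thesis
            using R by linarith
        qed
        ultimately show ?L
          by blast
      qed
    next
      fix e and m n :: nat assume "m < 2 ^ b e"
      then show "m mod n \<le> 2 ^ b e"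
        by (meson less_imp_le mod_less_eq_dividend order_trans)
    qed (intro ame_intros mod.IH mod.prems b assms(2) less | assumption | simp)+
  next
    case (exp2 f)
    obtain b where b: "ame b" "\<And>e z. z < y e \<Longrightarrow> f (e(k := z)) \<le> b e"
      using ame_majorant[OF exp2.hyps(1) assms(2)] by blast
    have less: "f (e(k := z)) < 2 ^ b e" if "z < y e" for e z
      using b(2)[OF that] less_exp[of "b e"] by linarith
    have ame0: "ame (\<lambda>e. \<Sum>z<y e. 0 * 2 ^ (2 * b e * z))"
      by (simp add: ame.const)
    \<comment> \<open>Only one operand is present, so \<open>v\<close> is 0 and all witnesses for
      \<open>P\<close> are pinned to 0; the value is directly an exponential monomial in the decoded
      digit \<open>a 1\<close>.\<close>
    show ?case
    proof (rule ame_packed_sum_map[where w = b and S = "\<lambda>e. 2 ^ 2 ^ b e" and h = "\<lambda>m _. 2 ^ m"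
        and v = "\<lambda>_ _. 0" and P = "\<lambda>e a. a 6 = 0 \<and> a 7 = 0 \<and> a 8 = 0"
        and C = "\<lambda>e a. 2 ^ (1 * a 1)" and q = "\<lambda>_ _. 0" and r = "\<lambda>_ _. 0" and r' = "\<lambda>_ _. 0"])
      show "exp_eq 11 (\<lambda>e a. a 6 = 0 \<and> a 7 = 0 \<and> a 8 = 0)"
        by (intro exp_eq_intros exp_poly_intros ame.const) simp_all
      show "exp_poly 11 (\<lambda>e a. 2 ^ (1 * a 1))"
        by (intro exp_poly_exp ame.const) simp
      fix e and m :: nat assume "m < 2 ^ b e"
      then show "2 ^ m \<le> (2::nat) ^ 2 ^ b e"
        by (intro power_increasing) auto
    qed (intro ame_intros exp2.IH exp2.prems b assms(2) less ame0 | assumption | auto)+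
  qed
qed

lemma ame_env_sum:
  assumes "ame f" "ame y"
  shows "ame (\<lambda>e. \<Sum>z<y e. f (e(k := z)))"
  using ame_packed_sum[OF assms ame.const[of 0]] by simp

section \<open>Nested sums and bounded products\<close>

lemma ame_shift: "ame g \<Longrightarrow> ame (\<lambda>e. g (\<lambda>i. e (Suc i)))"
  by (erule ame_subst) (rule ame.var)

text \<open>Variables are numbered in de Bruijn style: the summation variable has index 0 and the
  others are shifted, so that nested sums do not capture variables of \<open>f\<close>.\<close>

lemma ame_bounded_sum:
  assumes "ame (\<lambda>e. H (e 0) (\<lambda>i. e (Suc i)))" "ame y"
  shows "ame (\<lambda>e. \<Sum>z<y e. H z e)"
proof -
  have "ame (\<lambda>e. y (\<lambda>i. e (Suc i)))"
    using assms(2) by (rule ame_shift)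
  from ame_env_sum[OF assms(1) this, of 0]
  have "ame (\<lambda>e. \<Sum>z<y (\<lambda>i. e (Suc i)). H z (\<lambda>i. e (Suc i)))"
    by simp
  \<comment> \<open>The summation variable overwrites index 0, so any value may stand there when the
    shift is undone.\<close>
  then have "ame (\<lambda>e. (\<lambda>e. \<Sum>z<y (\<lambda>i. e (Suc i)). H z (\<lambda>i. e (Suc i))) (\<lambda>i. case i of 0 \<Rightarrow> 0 | Suc j \<Rightarrow> e j))"
  proof (rule ame_subst)
    show "ame (\<lambda>e. case i of 0 \<Rightarrow> 0 | Suc j \<Rightarrow> e j)" for i
      by (cases i) (simp_all add: ame.const ame.var)
  qed
  then show ?thesis
    by simp
qed

text \<open>The product counts the tuples whose entry \<open>z\<close> is below \<open>f z\<close>.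
  As \<open>f z < W\<close>, such tuples are strings of \<open>y\<close> digits in base
  \<open>W\<close>; the induction splits off the top digit.\<close>

lemma prod_eq_card_digits:
  fixes f :: "nat \<Rightarrow> nat"
  assumes "\<And>z. z < y \<Longrightarrow> f z < W"
  shows "(\<Prod>z<y. f z) = card {c. c < W ^ y \<and> (\<forall>z<y. c div W ^ z mod W < f z)}"
  using assms
proof (induction y)
  case 0
  have "{c. c < Suc 0} = {0}" by auto
  then show ?case by simp
next
  case (Suc y)
  define D where "D y = {c. c < W ^ y \<and> (\<forall>z<y. c div W ^ z mod W < f z)}" for y
  have "W > 0"
    using Suc.prems[of 0] by simp
  have "bij_betw (\<lambda>c. (c mod W ^ y, c div W ^ y)) (D (Suc y)) (D y \<times> {..<f y})"
  proof (rule bij_betw_byWitness[where f' = "\<lambda>(c, d). c + d * W ^ y"])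
    have mod_digit: "c mod W ^ y div W ^ z mod W = c div W ^ z mod W" if z: "z < y" for c z
    proof -
      obtain k where k: "y = z + Suc k"
        using less_imp_Suc_add[OF z] by auto
      have "c mod W ^ y div W ^ z = c div W ^ z mod W ^ Suc k"
        unfolding k power_add by (subst mod_mult2_eq) (simp add: \<open>W > 0\<close>)
      then show ?thesis
        by (simp add: mod_mod_cancel)
    qed
    have add_digit: "(c + d * W ^ y) div W ^ z mod W = c div W ^ z mod W" if "z < y" "c < W ^ y" for c d z
      using mod_digit[OF that(1), of "c + d * W ^ y"] that(2) by simp
    have div_less: "c div W ^ y < W" if "c < W ^ Suc y" for c
      using that by (simp add: less_mult_imp_div_less)
    show "\<forall>c\<in>D (Suc y). (case (c mod W ^ y, c div W ^ y) of (c, d) \<Rightarrow> c + d * W ^ y) = c"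
      by (simp add: mod_div_mult_eq)
    show "\<forall>p\<in>D y \<times> {..<f y}. ((case p of (c, d) \<Rightarrow> c + d * W ^ y) mod W ^ y, (case p of (c, d) \<Rightarrow> c + d * W ^ y) div W ^ y) = p"
      using \<open>W > 0\<close> by (auto simp: D_def)
    show "(\<lambda>c. (c mod W ^ y, c div W ^ y)) ` D (Suc y) \<subseteq> D y \<times> {..<f y}"
    proof (rule image_subsetI)
      fix c assume c: "c \<in> D (Suc y)"
      then have "c div W ^ y < f y"
        using div_less[of c] by (auto simp: D_def dest!: spec[of _ y])
      then show "(c mod W ^ y, c div W ^ y) \<in> D y \<times> {..<f y}"
        using c \<open>W > 0\<close> by (auto simp: D_def mod_digit)
    qed
    show "(\<lambda>(c, d). c + d * W ^ y) ` (D y \<times> {..<f y}) \<subseteq> D (Suc y)"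
    proof (rule image_subsetI)
      fix p assume "p \<in> D y \<times> {..<f y}"
      then obtain c d where p: "p = (c, d)" and c: "c \<in> D y" and d: "d \<in> {..<f y}"
        by blast
      then have less: "c < W ^ y" "d < W"
        using Suc.prems[of y] by (auto simp: D_def)
      have "(d + 1) * W ^ y \<le> W * W ^ y"
        using less by (intro mult_right_mono) auto
      then have "c + d * W ^ y < W ^ Suc y"
        using less by simp
      moreover have "(c + d * W ^ y) div W ^ z mod W < f z" if "z < Suc y" for z
      proof (cases "z = y")
        case True
        then show ?thesis
          using less d by simp
      next
        case False
        then show ?thesis
          using that less c by (simp add: add_digit D_def)
      qed
      ultimately show "(case p of (c, d) \<Rightarrow> c + d * W ^ y) \<in> D (Suc y)"
        by (simp add: D_def p)
    qed
  qed
  then have "card (D (Suc y)) = card (D y \<times> {..<f y})"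
    by (rule bij_betw_same_card)
  moreover have "(\<Prod>z<y. f z) = card (D y)"
    unfolding D_def by (intro Suc.IH Suc.prems) simp
  ultimately show ?case
    unfolding D_def[of "Suc y", symmetric] by (simp add: card_cartesian_product)
qed

lemma ame_env_prod:
  assumes f: "ame f" and y: "ame y"
  shows "ame (\<lambda>e. \<Prod>z<y e. f (e(k := z)))"
proof -
  \<comment> \<open>One more than the sum of the factors exceeds each of them.\<close>
  define W where "W e = (\<Sum>z<y e. f (e(k := z))) + 1" for e
  have W: "ame W"
    unfolding W_def by (intro ame_intros ame_env_sum f y)
  have "f (e(k := z)) < W e" if "z < y e" for e z
    using member_le_sum[of z "{..<y e}" "\<lambda>z. f (e(k := z))"] that by (simp add: W_def)
  then have "(\<Prod>z<y e. f (e(k := z))) = card {c. c < W e ^ y e \<and> (\<forall>z<y e. c div W e ^ z mod W e < f (e(k := z)))}" for e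
    by (rule prod_eq_card_digits)
  \<comment> \<open>A term of the inner sum is 1 exactly for a digit that is not below its bound, so
    subtracting that sum from 1 gives the indicator of the digit condition.\<close>
  also have "card {c. c < W e ^ y e \<and> (\<forall>z<y e. c div W e ^ z mod W e < f (e(k := z)))} =
      (\<Sum>c<W e ^ y e. 1 - (\<Sum>z<y e. 1 - (f (e(k := z)) - c div W e ^ z mod W e)))" for e
  proof -
    have *: "1 - (\<Sum>z<y e. 1 - (f (e(k := z)) - c div W e ^ z mod W e)) =
      (if \<forall>z<y e. c div W e ^ z mod W e < f (e(k := z)) then 1 else 0)" for c
    proof -
      have "(\<Sum>z<y e. 1 - (f (e(k := z)) - c div W e ^ z mod W e)) = 0 \<longleftrightarrow>
          (\<forall>z<y e. c div W e ^ z mod W e < f (e(k := z)))"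
        by (auto simp: Suc_le_eq)
      moreover have "1 - s = (if s = 0 then 1 else 0)" for s :: nat
        by simp
      ultimately show ?thesis
        by (simp only:)
    qed
    show ?thesis
      unfolding * by (simp add: sum.If_cases Int_def)
  qed
  finally have eq: "(\<Prod>z<y e. f (e(k := z))) =
      (\<Sum>c<W e ^ y e. 1 - (\<Sum>z<y e. 1 - (f (e(k := z)) - c div W e ^ z mod W e)))" for e .
  \<comment> \<open>Under both sums index 0 is the position \<open>z\<close>, index 1 the digit
    string \<open>c\<close>, and the original variables move up by two.\<close>
  have "ame (\<lambda>e. if i = k then e 0 else e (Suc (Suc i)))" for i
    by (cases "i = k") (simp_all add: ame.var)
  from ame_subst[OF f this] have "ame (\<lambda>e. f ((\<lambda>i. e (Suc (Suc i)))(k := e 0)))"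
    by (simp add: fun_upd_def)
  then have "ame (\<lambda>e. 1 - (f ((\<lambda>i. e (Suc (Suc i)))(k := e 0)) -
      e 1 div W (\<lambda>i. e (Suc (Suc i))) ^ e 0 mod W (\<lambda>i. e (Suc (Suc i)))))"
    by (intro ame_intros ame_shift[OF ame_shift[OF W]])
  then have "ame (\<lambda>e. \<Sum>z<y (\<lambda>i. e (Suc i)). 1 - (f ((\<lambda>i. e (Suc i))(k := z)) -
      e 0 div W (\<lambda>i. e (Suc i)) ^ z mod W (\<lambda>i. e (Suc i))))"
    by (intro ame_bounded_sum[where H = "\<lambda>z e. 1 - (f ((\<lambda>i. e (Suc i))(k := z)) -
      e 0 div W (\<lambda>i. e (Suc i)) ^ z mod W (\<lambda>i. e (Suc i)))"] ame_shift[OF y]) simp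
  then have "ame (\<lambda>e. 1 - (\<Sum>z<y (\<lambda>i. e (Suc i)). 1 - (f ((\<lambda>i. e (Suc i))(k := z)) -
      e 0 div W (\<lambda>i. e (Suc i)) ^ z mod W (\<lambda>i. e (Suc i)))))"
    by (intro ame_diff ame.const)
  then have "ame (\<lambda>e. \<Sum>c<W e ^ y e. 1 - (\<Sum>z<y e. 1 - (f (e(k := z)) - c div W e ^ z mod W e)))"
    by (intro ame_bounded_sum[where H = "\<lambda>c e. 1 - (\<Sum>z<y e. 1 - (f (e(k := z)) - c div W e ^ z mod W e))"]
      ame_power W y)
  then show ?thesis
    by (simp only: eq)
qed

section \<open>Operations on argument lists\<close>

lemma mk_op_cong: "(\<And>xs. length xs = n \<Longrightarrow> f xs = g xs) \<Longrightarrow> mk_op n f = mk_op n g"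
  unfolding mk_op_def by (auto intro!: restrict_ext)

lemma mk_op_eqD: "(n, f) = mk_op m g \<Longrightarrow> n = m \<and> (\<forall>xs. length xs = n \<longrightarrow> f xs = g xs)"
  by (auto simp: mk_op_def)

lemma closed_under_substitutionD:
  assumes "closed_under_substitution S" "mk_op (length gs) f \<in> S" "\<And>g. g \<in> set gs \<Longrightarrow> mk_op n g \<in> S"
  shows "mk_op n (\<lambda>xs. f (map (\<lambda>g. g xs) gs)) \<in> S"
proof -
  let ?f = "restrict f {xs. length xs = length gs}"
  let ?gs = "map (\<lambda>g. restrict g {xs. length xs = n}) gs"
  have "mk_op n (\<lambda>xs. ?f (map (\<lambda>g. g xs) ?gs)) \<in> S"
    using assms(1)[unfolded closed_under_substitution_def, rule_format, of "length gs" ?f ?gs n] assms(2,3)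
    by (auto simp: mk_op_def)
  moreover have "mk_op n (\<lambda>xs. ?f (map (\<lambda>g. g xs) ?gs)) = mk_op n (\<lambda>xs. f (map (\<lambda>g. g xs) gs))"
    by (intro mk_op_cong) (simp add: comp_def)
  ultimately show ?thesis
    by simp
qed

lemma closed_under_binary_op:
  assumes "closed_under_substitution S" "binary_op h \<in> S" "mk_op n f \<in> S" "mk_op n g \<in> S"
  shows "mk_op n (\<lambda>xs. h (f xs) (g xs)) \<in> S"
  using closed_under_substitutionD[OF assms(1), of "[f, g]" "\<lambda>xs. h (xs ! 0) (xs ! 1)" n] assms
  by (auto simp: binary_op_def numeral_2_eq_2)

lemma closed_under_unary_op:
  assumes "closed_under_substitution S" "unary_op h \<in> S" "mk_op n f \<in> S"
  shows "mk_op n (\<lambda>xs. h (f xs)) \<in> S"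
  using closed_under_substitutionD[OF assms(1), of "[f]" "\<lambda>xs. h (xs ! 0)" n] assms
  by (auto simp: unary_op_def)

text \<open>An out-of-range entry is unspecified but depends only on the excess
  \<open>i - length xs\<close>. In a fixed arity, a variable beyond the arguments therefore acts as
  a constant.\<close>

lemma nth_beyond_length: "length xs \<le> i \<Longrightarrow> xs ! i = [] ! (i - length xs)"
  using nth_append[of xs "[]" i] by simp

lemma ame_in_closed_class:
  assumes "closed_under_substitution S" "const_ops \<subseteq> S" "proj_ops \<subseteq> S"
    and "binary_op (+) \<in> S" "binary_op (mod) \<in> S" "unary_op (\<lambda>x. 2 ^ x) \<in> S"
    and "1 \<le> n" "ame F"
  shows "mk_op n (\<lambda>xs. F ((!) xs)) \<in> S"
  using assms(8)
proof induction
  case (const c)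
  then show ?case
    using assms(2,7) by (auto simp: const_ops_def)
next
  case (var i)
  show ?case
  proof (cases "i < n")
    case True
    then show ?thesis
      using assms(3) by (auto simp: proj_ops_def)
  next
    case False
    then have "mk_op n (\<lambda>xs. xs ! i) = mk_op n (\<lambda>xs. [] ! (i - n))"
      by (intro mk_op_cong, subst nth_beyond_length) auto
    then show ?thesis
      using assms(2,7) by (auto simp: const_ops_def)
  qed
next
  case (add f g)
  show ?case
    by (rule closed_under_binary_op[OF assms(1,4) add.IH])
next
  case (mod f g)
  show ?case
    by (rule closed_under_binary_op[OF assms(1,5) mod.IH])
next
  case (exp2 f)
  show ?case
    by (rule closed_under_unary_op[OF assms(1,6) exp2.IH])
qed

definition ame_ops :: "operation set" where
  "ame_ops = {mk_op n (\<lambda>xs. F ((!) xs)) | n F. 1 \<le> n \<and> ame F}"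

lemma ame_opsI: "1 \<le> n \<Longrightarrow> ame F \<Longrightarrow> mk_op n (\<lambda>xs. F ((!) xs)) \<in> ame_ops"
  by (auto simp: ame_ops_def)

lemma ame_opsE:
  assumes "(n, f) \<in> ame_ops"
  obtains F where "1 \<le> n" "ame F" "\<And>xs. length xs = n \<Longrightarrow> f xs = F ((!) xs)"
  using assms by (auto simp: ame_ops_def dest!: mk_op_eqD)

lemma ame_ops_subset_operations: "ame_ops \<subseteq> operations"
  by (auto simp: ame_ops_def mk_op_in_operations)

lemma const_ops_subset_ame_ops: "const_ops \<subseteq> ame_ops"
  using ame_opsI[OF _ ame.const] by (fastforce simp: const_ops_def)

lemma proj_ops_subset_ame_ops: "proj_ops \<subseteq> ame_ops"
  using ame_opsI[OF _ ame.var] by (fastforce simp: proj_ops_def)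

lemma closed_under_substitution_ame_ops: "closed_under_substitution ame_ops"
  unfolding closed_under_substitution_def
proof (intro allI impI)
  fix r f n gs
  assume f: "(r, f) \<in> ame_ops" and len: "length gs = r" and gs: "\<forall>g\<in>set gs. (n, g) \<in> ame_ops"
  obtain F where F: "1 \<le> r" "ame F" "\<And>xs. length xs = r \<Longrightarrow> f xs = F ((!) xs)"
    by (rule ame_opsE[OF f]) blast
  have "\<exists>G. 1 \<le> n \<and> ame G \<and> (\<forall>xs. length xs = n \<longrightarrow> (gs ! i) xs = G ((!) xs))" if "i < r" for i
    using gs that len by (metis ame_opsE nth_mem)
  then obtain G where G: "\<And>i. i < r \<Longrightarrow> 1 \<le> n \<and> ame (G i) \<and> (\<forall>xs. length xs = n \<longrightarrow> (gs ! i) xs = G i ((!) xs))"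
    by metis
  \<comment> \<open>Beyond the \<open>r\<close> arguments of \<open>f\<close> the environment must
    agree with an out-of-range access to its argument list.\<close>
  have "ame (\<lambda>e. if i < r then G i e else [] ! (i - r))" for i
    using G by (cases "i < r") (auto intro: ame.const)
  then have "ame (\<lambda>e. F (\<lambda>i. if i < r then G i e else [] ! (i - r)))"
    by (rule ame_subst[OF F(2)])
  then have "mk_op n (\<lambda>xs. F (\<lambda>i. if i < r then G i ((!) xs) else [] ! (i - r))) \<in> ame_ops"
    using G[of 0] F(1) by (intro ame_opsI) auto
  moreover have "f (map (\<lambda>g. g xs) gs) = F (\<lambda>i. if i < r then G i ((!) xs) else [] ! (i - r))"
    if "length xs = n" for xs
  proof -
    have "(!) (map (\<lambda>g. g xs) gs) = (\<lambda>i. if i < r then G i ((!) xs) else [] ! (i - r))"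
    proof
      fix i
      show "map (\<lambda>g. g xs) gs ! i = (if i < r then G i ((!) xs) else [] ! (i - r))"
        using that G len nth_beyond_length[of "map (\<lambda>g. g xs) gs" i] by (cases "i < r") auto
    qed
    then show ?thesis
      using F(3)[of "map (\<lambda>g. g xs) gs"] len by simp
  qed
  ultimately show "mk_op n (\<lambda>xs. f (map (\<lambda>g. g xs) gs)) \<in> ame_ops"
    using mk_op_cong[of n "\<lambda>xs. f (map (\<lambda>g. g xs) gs)"] by simp
qed

text \<open>Links the summation variable in last place with an environment update. Out of range the
  two sides agree because the lists have equal length.\<close>

lemma nth_butlast_append:
  assumes "length xs = Suc n"
  shows "(!) (butlast xs @ [z]) = ((!) xs)(n := z)"
proof
  fix i
  show "(butlast xs @ [z]) ! i = (((!) xs)(n := z)) i"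
  proof (cases "i \<le> n")
    case True
    then show ?thesis
      using assms by (auto simp: nth_append nth_butlast)
  next
    case False
    then show ?thesis
      using assms nth_beyond_length[of xs i] nth_beyond_length[of "butlast xs @ [z]" i] by simp
  qed
qed

lemma last_eq_nth: "length xs = Suc n \<Longrightarrow> last xs = xs ! n"
  by (cases xs rule: rev_cases) auto

lemma closed_under_bounded_sum_ame_ops: "closed_under_bounded_sum ame_ops"
  unfolding closed_under_bounded_sum_def
proof (intro allI impI)
  fix n f assume "(Suc n, f) \<in> ame_ops"
  then obtain F where F: "ame F" "\<And>xs. length xs = Suc n \<Longrightarrow> f xs = F ((!) xs)"
    by (metis ame_opsE)
  have "mk_op (Suc n) (\<lambda>xs. \<Sum>z<xs ! n. F (((!) xs)(n := z))) \<in> ame_ops"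
    by (rule ame_opsI) (simp, intro ame_env_sum F ame.var)
  moreover have "mk_op (Suc n) (\<lambda>xs. \<Sum>z<last xs. f (butlast xs @ [z])) =
      mk_op (Suc n) (\<lambda>xs. \<Sum>z<xs ! n. F (((!) xs)(n := z)))"
    by (intro mk_op_cong) (simp add: F(2) nth_butlast_append last_eq_nth)
  ultimately show "mk_op (Suc n) (\<lambda>xs. \<Sum>z<last xs. f (butlast xs @ [z])) \<in> ame_ops"
    by simp
qed

lemma closed_under_bounded_prod_ame_ops: "closed_under_bounded_prod ame_ops"
  unfolding closed_under_bounded_prod_def
proof (intro allI impI)
  fix n f assume "(Suc n, f) \<in> ame_ops"
  then obtain F where F: "ame F" "\<And>xs. length xs = Suc n \<Longrightarrow> f xs = F ((!) xs)"
    by (metis ame_opsE)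
  have "mk_op (Suc n) (\<lambda>xs. \<Prod>z<xs ! n. F (((!) xs)(n := z))) \<in> ame_ops"
    by (rule ame_opsI) (simp, intro ame_env_prod F ame.var)
  moreover have "mk_op (Suc n) (\<lambda>xs. \<Prod>z<last xs. f (butlast xs @ [z])) =
      mk_op (Suc n) (\<lambda>xs. \<Prod>z<xs ! n. F (((!) xs)(n := z)))"
    by (intro mk_op_cong) (simp add: F(2) nth_butlast_append last_eq_nth)
  ultimately show "mk_op (Suc n) (\<lambda>xs. \<Prod>z<last xs. f (butlast xs @ [z])) \<in> ame_ops"
    by simp
qed

lemma binary_op_in_ame_ops: "ame (\<lambda>e. h (e 0) (e 1)) \<Longrightarrow> binary_op h \<in> ame_ops"
  unfolding binary_op_def by (drule ame_opsI[of 2, rotated]) simp_all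

lemma kalmar_elementary_subset_ame_ops: "kalmar_elementary \<subseteq> ame_ops"
  unfolding kalmar_elementary_def
proof (rule hull_minimal)
  have "binary_op (+) \<in> ame_ops" "binary_op (-) \<in> ame_ops"
    by (intro binary_op_in_ame_ops ame_intros)+
  then show "const_ops \<union> proj_ops \<union> {binary_op (+), binary_op (-)} \<subseteq> ame_ops"
    using const_ops_subset_ame_ops proj_ops_subset_ame_ops by simp
qed (intro conjI ame_ops_subset_operations closed_under_substitution_ame_ops
    closed_under_bounded_sum_ame_ops closed_under_bounded_prod_ame_ops)

section \<open>The generators are elementary\<close>

lemma closed_under_substitution_hull:
  assumes "\<And>S. P S \<Longrightarrow> closed_under_substitution S"
  shows "closed_under_substitution (P hull B)"
  unfolding closed_under_substitution_def
proof (intro allI impI)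
  fix r f n gs
  assume *: "(r, f) \<in> P hull B" "length gs = r" "\<forall>g\<in>set gs. (n, g) \<in> P hull B"
  have "mk_op n (\<lambda>xs. f (map (\<lambda>g. g xs) gs)) \<in> S" if S: "P S" "B \<subseteq> S" for S
  proof -
    have "P hull B \<subseteq> S"
      using S by (intro hull_minimal)
    then show ?thesis
      using * assms[OF S(1), unfolded closed_under_substitution_def, rule_format, of r f gs n] by blast
  qed
  then show "mk_op n (\<lambda>xs. f (map (\<lambda>g. g xs) gs)) \<in> P hull B"
    unfolding hull_def by blast
qed

lemma closed_under_bounded_sum_hull:
  assumes "\<And>S. P S \<Longrightarrow> closed_under_bounded_sum S"
  shows "closed_under_bounded_sum (P hull B)"
  using assms unfolding closed_under_bounded_sum_def hull_def by simp

lemma closed_under_bounded_prod_hull: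
  assumes "\<And>S. P S \<Longrightarrow> closed_under_bounded_prod S"
  shows "closed_under_bounded_prod (P hull B)"
  using assms unfolding closed_under_bounded_prod_def hull_def by simp

lemma
  shows kalmar_elementary_base: "const_ops \<union> proj_ops \<union> {binary_op (+), binary_op (-)} \<subseteq> kalmar_elementary"
    and kalmar_elementary_substitution: "closed_under_substitution kalmar_elementary"
    and kalmar_elementary_sum: "closed_under_bounded_sum kalmar_elementary"
    and kalmar_elementary_prod: "closed_under_bounded_prod kalmar_elementary"
  unfolding kalmar_elementary_def
  by (rule hull_subset, rule closed_under_substitution_hull, simp,
      rule closed_under_bounded_sum_hull, simp, rule closed_under_bounded_prod_hull, simp)

lemma kalmar_const: "1 \<le> n \<Longrightarrow> mk_op n (\<lambda>xs. c) \<in> kalmar_elementary"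
  using kalmar_elementary_base by (auto simp: const_ops_def)

lemma kalmar_proj: "i < n \<Longrightarrow> mk_op n (\<lambda>xs. xs ! i) \<in> kalmar_elementary"
  using kalmar_elementary_base by (auto simp: proj_ops_def)

lemmas kalmar_binary = closed_under_binary_op[OF kalmar_elementary_substitution]

lemma kalmar_add_diff: "binary_op (+) \<in> kalmar_elementary" "binary_op (-) \<in> kalmar_elementary"
  using kalmar_elementary_base by auto

lemma kalmar_bounded_sum:
  assumes "mk_op (Suc n) f \<in> kalmar_elementary"
  shows "mk_op (Suc n) (\<lambda>xs. \<Sum>z<last xs. f (butlast xs @ [z])) \<in> kalmar_elementary"
proof -
  have "mk_op (Suc n) (\<lambda>xs. \<Sum>z<last xs. restrict f {xs. length xs = Suc n} (butlast xs @ [z])) \<in> kalmar_elementary"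
    using assms kalmar_elementary_sum[unfolded closed_under_bounded_sum_def, rule_format, of n "restrict f {xs. length xs = Suc n}"]
    by (simp only: mk_op_def)
  also have "mk_op (Suc n) (\<lambda>xs. \<Sum>z<last xs. restrict f {xs. length xs = Suc n} (butlast xs @ [z])) =
      mk_op (Suc n) (\<lambda>xs. \<Sum>z<last xs. f (butlast xs @ [z]))"
    by (intro mk_op_cong) simp
  finally show ?thesis .
qed

lemma kalmar_mult: "binary_op (*) \<in> kalmar_elementary"
proof -
  have "mk_op 2 (\<lambda>xs. \<Sum>z<last xs. (butlast xs @ [z]) ! 0) \<in> kalmar_elementary"
    using kalmar_bounded_sum[of 1 "\<lambda>xs. xs ! 0"] kalmar_proj[of 0 2] by (simp add: numeral_2_eq_2)
  also have "mk_op 2 (\<lambda>xs. \<Sum>z<last xs. (butlast xs @ [z]) ! 0) = binary_op (*)"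
    unfolding binary_op_def
    by (intro mk_op_cong) (auto simp: nth_butlast_append[of _ 1] last_eq_nth[of _ 1])
  finally show ?thesis .
qed

text \<open>The quotient counts the positive multiples \<open>Suc z * y\<close> up to
  \<open>x\<close>, and there are at most \<open>x\<close> of them.\<close>

lemma div_eq_sum: "x div y = (\<Sum>z<x. 1 - (Suc z * y - x))" if "y > 0" for x y :: nat
proof -
  have "1 - (Suc z * y - x) = (if z < x div y then 1 else 0)" for z
    using that by (auto simp: less_eq_div_iff_mult_less_eq Suc_le_eq[symmetric])
  moreover have "{..<x} \<inter> {z. z < x div y} = {..<x div y}"
    using div_le_dividend[of x y] by (auto intro: less_le_trans)
  ultimately show ?thesis
    by (simp add: sum.If_cases)
qed

text \<open>For \<open>y = 0\<close> the factor \<open>y\<close> removes the sum, in accordance with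
  \<open>x mod 0 = x\<close>.\<close>

lemma mod_eq_sum: "x mod y = x - y * (\<Sum>z<x. 1 - (Suc z * y - x))" for x y :: nat
  by (cases "y = 0") (simp_all only: div_eq_sum[symmetric] minus_mult_div_eq_mod, simp_all)

lemma kalmar_mod: "binary_op (mod) \<in> kalmar_elementary"
proof -
  note binary = kalmar_binary[OF kalmar_add_diff(1)] kalmar_binary[OF kalmar_add_diff(2)]
    kalmar_binary[OF kalmar_mult]
  \<comment> \<open>The bound of a sum has to be the last argument, so the summation variable
    becomes a third argument; afterwards the bound is identified with the first argument by
    substitution.\<close>
  let ?f = "\<lambda>xs. 1 - ((xs ! 2 + 1) * xs ! 1 - xs ! 0)"
  have "mk_op (Suc 2) ?f \<in> kalmar_elementary"
    by (intro binary kalmar_const kalmar_proj) simp_all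
  then have "mk_op 3 (\<lambda>xs. \<Sum>z<last xs. ?f (butlast xs @ [z])) \<in> kalmar_elementary"
    using kalmar_bounded_sum[of 2 ?f] by (simp only: Suc_numeral semiring_norm)
  also have "mk_op 3 (\<lambda>xs. \<Sum>z<last xs. ?f (butlast xs @ [z])) = mk_op 3 (\<lambda>xs. \<Sum>z<xs ! 2. 1 - (Suc z * xs ! 1 - xs ! 0))"
    by (intro mk_op_cong) (auto simp: nth_butlast_append[of _ 2] last_eq_nth[of _ 2])
  finally have *: "mk_op (length [\<lambda>xs. xs ! 0, \<lambda>xs. xs ! 1, \<lambda>xs. xs ! 0])
      (\<lambda>xs. \<Sum>z<xs ! 2. 1 - (Suc z * xs ! 1 - xs ! 0)) \<in> kalmar_elementary"
    by (simp add: numeral_3_eq_3)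
  have "mk_op 2 (\<lambda>xs. \<Sum>z<xs ! 0. 1 - (Suc z * xs ! 1 - xs ! 0)) \<in> kalmar_elementary"
    using closed_under_substitutionD[OF kalmar_elementary_substitution *, of 2] kalmar_proj[of 0 2] kalmar_proj[of 1 2]
    by (auto simp: numeral_2_eq_2)
  then have "mk_op 2 (\<lambda>xs. xs ! 0 - xs ! 1 * (\<Sum>z<xs ! 0. 1 - (Suc z * xs ! 1 - xs ! 0))) \<in> kalmar_elementary"
    by (intro binary kalmar_proj) simp_all
  then show ?thesis
    by (simp only: binary_op_def mod_eq_sum[symmetric])
qed

lemma kalmar_exp2: "unary_op (\<lambda>x. 2 ^ x) \<in> kalmar_elementary"
proof -
  have "(Suc 0, restrict (\<lambda>xs. 2) {xs. length xs = Suc 0}) \<in> kalmar_elementary"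
    using kalmar_const[of 1 2] by (simp add: mk_op_def)
  then have "mk_op 1 (\<lambda>xs. \<Prod>z<last xs. restrict (\<lambda>xs. 2) {xs. length xs = Suc 0} (butlast xs @ [z])) \<in> kalmar_elementary"
    using kalmar_elementary_prod unfolding closed_under_bounded_prod_def by fastforce
  also have "mk_op 1 (\<lambda>xs. \<Prod>z<last xs. restrict (\<lambda>xs. 2) {xs. length xs = Suc 0} (butlast xs @ [z])) =
      unary_op (\<lambda>x. 2 ^ x)"
    unfolding unary_op_def by (intro mk_op_cong) (simp add: last_eq_nth)
  finally show ?thesis .
qed

theorem theorem1:
  "substitution_closure {binary_op (+), binary_op (mod), unary_op (\<lambda>x. 2 ^ x)} = kalmar_elementary"
proof
  show "substitution_closure {binary_op (+), binary_op (mod), unary_op (\<lambda>x. 2 ^ x)} \<subseteq> kalmar_elementary"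
    unfolding substitution_closure_def
    using kalmar_elementary_base kalmar_mod kalmar_exp2
    by (intro hull_minimal conjI kalmar_elementary_subset_operations kalmar_elementary_substitution) auto
  let ?B = "{binary_op (+), binary_op (mod), unary_op (\<lambda>x. 2 ^ x)}"
  have sub: "?B \<union> const_ops \<union> proj_ops \<subseteq> substitution_closure ?B"
    unfolding substitution_closure_def by (rule hull_subset)
  have closed: "closed_under_substitution (substitution_closure ?B)"
    unfolding substitution_closure_def by (rule closed_under_substitution_hull) simp
  \<comment> \<open>The elementary functions lie in \<open>ame_ops\<close>, so it remains to
    generate the latter by substitution.\<close>
  have "ame_ops \<subseteq> substitution_closure ?B"
  proof
    fix p assume "p \<in> ame_ops"
    then obtain n F where p: "1 \<le> n" "ame F" "p = mk_op n (\<lambda>xs. F ((!) xs))"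
      unfolding ame_ops_def by blast
    show "p \<in> substitution_closure ?B"
      unfolding p(3) by (rule ame_in_closed_class[OF closed _ _ _ _ _ p(1,2)]) (use sub in blast)+
  qed
  then show "kalmar_elementary \<subseteq> substitution_closure ?B"
    using kalmar_elementary_subset_ame_ops by blast
qed

end
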